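(* Let $\mathcal P=\langle X:\mathcal R\rangle$ be a presentation of a group $G$ with presentation map $\theta:F(X)\to G$, and let $N=\ker\theta$, so that $N^{ab}$ is the relation module of $\mathcal P$. Then there is a short exact sequence of $G$-modules $$0\to\pi_1(\mathrm{Sq}^{\rho}(\mathcal P),1)\to\bigoplus_{r\in\mathcal R}\mathbb Z G\to N^{ab}\to0.$$
   Context: A group presentation $\mathcal P=\langle X:\mathcal R\rangle$ consists of a set $X$ and a set $\mathcal R\subseteq A^*\times A^*$ of pairs of words, where $A=X\cup X^{-1}$ and $A^*$ is the free monoid on $A$. $F(X)$ is the free group on $X$. The canonical map $\rho:A^*\to F(X)$ is suppressed: for $p,q\in F(X)$ and $(l,r)\in\mathcal R$, $plq$ and $prq$ denote $p(l\rho)q,\ p(r\rho)q\in F(X)$. The group presented is $G=F(X)/N$, where $N$ is the normal closure of $\{(l^{-1}r)\rho:(l,r)\in\mathcal R\}$; $\theta:F(X)\to G$ is the quotient map. The direct sum is indexed by the elements of $\mathcal R$ (the pairs). Reduced Squier complex $\mathrm{Sq}^{\rho}(\mathcal P)$: the 2-complex with vertex set $F(X)$; one edge $(p,l,r,q)$ for each $p,q\in F(X)$ and $(l,r)\in\mathcal R$, starting at $plq$ and ending at $prq$; and, for all $p,q,p',q'\in F(X)$ and $(l,r),(l',r')\in\mathcal R$, a 2-cell making the edge paths $(p,l,r,qp'l'q')\circ(prqp',l',r',q')$ and $(plqp',l',r',q')\circ(p,l,r,qp'r'q')$ homotopic. $\pi_1(\mathrm{Sq}^{\rho}(\mathcal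 P),1)$ is the fundamental group at the vertex $1\in F(X)$: homotopy classes of closed edge paths at $1$ (paths may traverse edges backwards). $G$-module structures (right modules): $F(X)$ acts on the left and right of homotopy classes of paths by the actions induced by $u\triangleright(p,l,r,q)=(up,l,r,q)$ and $(p,l,r,q)\triangleleft v=(p,l,r,qv)$ on edges; $\pi_1(\mathrm{Sq}^{\rho}(\mathcal P),1)$ is abelian, and the action $\alpha^q=q^{-1}\triangleright\alpha\triangleleft q$ of $q\in F(X)$ on it is trivial for $q\in N$, so it is a $G$-module. $N^{ab}$ is a $G$-module via conjugation $n\mapsto q^{-1}nq$ by $q\in F(X)$. *)

theory Defs
  imports "HOL-Algebra.Free_Abelian_Groups"
begin

section \<open>Free groups and group presentations\<close>

text \<open>The letter \<open>(x, True)\<close> stands for the generator \<open>x\<close> and \<open>(x, False)\<close> for its formal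
  inverse. The free group \<open>F(X)\<close> consists of the reduced words over \<open>X \<union> X\<^sup>-\<^sup>1\<close>.\<close>

type_synonym 'x letter = "'x \<times> bool"
type_synonym 'x word = "'x letter list"

definition words :: "'x set \<Rightarrow> 'x word set" where
  "words X = lists (X \<times> UNIV)"

fun inv_letter :: "'x letter \<Rightarrow> 'x letter" where
  "inv_letter (x, b) = (x, \<not> b)"

fun reduced :: "'x word \<Rightarrow> bool" where
  "reduced (a # b # w) \<longleftrightarrow> b \<noteq> inv_letter a \<and> reduced (b # w)"
| "reduced _ \<longleftrightarrow> True"

fun cancel_cons :: "'x letter \<Rightarrow> 'x word \<Rightarrow> 'x word" where
  "cancel_cons a [] = [a]"
| "cancel_cons a (b # w) = (if b = inv_letter a then w else a # b # w)"

text \<open>The canonical map \<open>\<rho>\<close> from words to the free group.\<close>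

definition free_reduction :: "'x word \<Rightarrow> 'x word" where
  "free_reduction w = foldr cancel_cons w []"

definition free_group :: "'x set \<Rightarrow> 'x word monoid" where
  "free_group X = \<lparr>carrier = {w \<in> words X. reduced w},
     monoid.mult = (\<lambda>u v. free_reduction (u @ v)), one = []\<rparr>"

definition normal_closure :: "('a, 'b) monoid_scheme \<Rightarrow> 'a set \<Rightarrow> 'a set" where
  "normal_closure G S = \<Inter>{N. N \<lhd> G \<and> S \<subseteq> N}"

definition relators :: "'x set \<Rightarrow> ('x word \<times> 'x word) set \<Rightarrow> 'x word set" where
  "relators X R =
     {inv\<^bsub>free_group X\<^esub> (free_reduction l) \<otimes>\<^bsub>free_group X\<^esub> free_reduction r | l r. (l, r) \<in> R}"

definition is_presentation ::
  "'x set \<Rightarrow> ('x word \<times> 'x word) set \<Rightarrow> ('g, 'm) monoid_scheme \<Rightarrow> ('x word \<Rightarrow> 'g) \<Rightarrow> bool" where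
  "is_presentation X R G \<theta> \<longleftrightarrow>
     R \<subseteq> words X \<times> words X \<and> group G \<and> \<theta> \<in> epi (free_group X) G \<and>
     kernel (free_group X) G \<theta> = normal_closure (free_group X) (relators X R)"


section \<open>Combinatorial 2-complexes\<close>

text \<open>A path is a list of edges with a direction (\<open>True\<close>: from source to target). A 2-cell is
  given by a pair of paths, which it makes homotopic.\<close>

type_synonym 'e path = "('e \<times> bool) list"

record ('v, 'e) two_complex =
  verts :: "'v set"
  edges :: "'e set"
  src :: "'e \<Rightarrow> 'v"
  tgt :: "'e \<Rightarrow> 'v"
  cells :: "('e path \<times> 'e path) set"

fun is_path :: "('v, 'e) two_complex \<Rightarrow> 'v \<Rightarrow> 'e path \<Rightarrow> 'v \<Rightarrow> bool" where
  "is_path K v [] w \<longleftrightarrow> v \<in> verts K \<and> v = w"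
| "is_path K v ((e, s) # p) w \<longleftrightarrow> v \<in> verts K \<and> e \<in> edges K \<and>
     v = (if s then src K e else tgt K e) \<and> is_path K (if s then tgt K e else src K e) p w"

definition loops :: "('v, 'e) two_complex \<Rightarrow> 'v \<Rightarrow> 'e path set" where
  "loops K v = {p. is_path K v p v}"

inductive homotopy_step :: "('v, 'e) two_complex \<Rightarrow> 'e path \<Rightarrow> 'e path \<Rightarrow> bool"
  for K where
  backtrack: "homotopy_step K (p @ [(e, s), (e, \<not> s)] @ q) (p @ q)"
| cell: "(c, d) \<in> cells K \<Longrightarrow> homotopy_step K (p @ c @ q) (p @ d @ q)"

text \<open>The intermediate stages of a homotopy between loops at \<open>v\<close> are required to be loops
  at \<open>v\<close> as well.\<close>

definition loop_homotopy :: "('v, 'e) two_complex \<Rightarrow> 'v \<Rightarrow> ('e path \<times> 'e path) set" where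
  "loop_homotopy K v = {(p, q). p \<in> loops K v \<and> q \<in> loops K v \<and>
     equivclp (\<lambda>a b. a \<in> loops K v \<and> b \<in> loops K v \<and> homotopy_step K a b) p q}"

definition fundamental_group :: "('v, 'e) two_complex \<Rightarrow> 'v \<Rightarrow> 'e path set monoid" where
  "fundamental_group K v = \<lparr>carrier = loops K v // loop_homotopy K v,
     monoid.mult = (\<lambda>\<alpha> \<beta>. \<Union>a\<in>\<alpha>. \<Union>b\<in>\<beta>. loop_homotopy K v `` {a @ b}),
     one = loop_homotopy K v `` {[]}\<rparr>"


section \<open>The reduced Squier complex\<close>

type_synonym 'x sq_edge = "'x word \<times> 'x word \<times> 'x word \<times> 'x word"

definition squier_complex ::
  "'x set \<Rightarrow> ('x word \<times> 'x word) set \<Rightarrow> ('x word, 'x sq_edge) two_complex" where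
  "squier_complex X R =
    (let F = carrier (free_group X);
         m = (\<lambda>u v. u \<otimes>\<^bsub>free_group X\<^esub> v);
         \<rho> = free_reduction
     in \<lparr>verts = F,
         edges = {(p, l, r, q) | p l r q. p \<in> F \<and> q \<in> F \<and> (l, r) \<in> R},
         src = (\<lambda>(p, l, r, q). m (m p (\<rho> l)) q),
         tgt = (\<lambda>(p, l, r, q). m (m p (\<rho> r)) q),
         cells = {([((p, l, r, m (m (m q p') (\<rho> l')) q'), True),
                    ((m (m (m p (\<rho> r)) q) p', l', r', q'), True)],
                   [((m (m (m p (\<rho> l)) q) p', l', r', q'), True),
                    ((p, l, r, m (m (m q p') (\<rho> r')) q'), True)])
                  | p l r q p' l' r' q'.
                  p \<in> F \<and> q \<in> F \<and> p' \<in> F \<and> q' \<in> F \<and> (l, r) \<in> R \<and> (l', r') \<in> R}\<rparr>)"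

definition left_whisker :: "'x set \<Rightarrow> 'x word \<Rightarrow> 'x sq_edge path \<Rightarrow> 'x sq_edge path" where
  "left_whisker X u = map (\<lambda>((p, l, r, q), s). ((u \<otimes>\<^bsub>free_group X\<^esub> p, l, r, q), s))"

definition right_whisker :: "'x set \<Rightarrow> 'x sq_edge path \<Rightarrow> 'x word \<Rightarrow> 'x sq_edge path" where
  "right_whisker X a v = map (\<lambda>((p, l, r, q), s). ((p, l, r, q \<otimes>\<^bsub>free_group X\<^esub> v), s)) a"

abbreviation squier_pi1 ::
  "'x set \<Rightarrow> ('x word \<times> 'x word) set \<Rightarrow> 'x sq_edge path set monoid" where
  "squier_pi1 X R \<equiv> fundamental_group (squier_complex X R) []"


section \<open>Right modules over a group\<close>

locale right_gmodule = G: group G + M: comm_group M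
  for G :: "('g, 'm) monoid_scheme" and M :: "('a, 'n) monoid_scheme"
    and act :: "'a \<Rightarrow> 'g \<Rightarrow> 'a" +
  assumes act_hom: "g \<in> carrier G \<Longrightarrow> (\<lambda>x. act x g) \<in> hom M M"
    and act_one: "x \<in> carrier M \<Longrightarrow> act x \<one>\<^bsub>G\<^esub> = x"
    and act_mult: "\<lbrakk>x \<in> carrier M; g \<in> carrier G; h \<in> carrier G\<rbrakk> \<Longrightarrow>
      act x (g \<otimes>\<^bsub>G\<^esub> h) = act (act x g) h"

locale right_gmodule_hom = A: right_gmodule G A actA + B: right_gmodule G B actB
  for G :: "('g, 'm) monoid_scheme"
    and A :: "('a, 'n) monoid_scheme" and actA
    and B :: "('b, 'k) monoid_scheme" and actB
    and f :: "'a \<Rightarrow> 'b" +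
  assumes hom: "f \<in> hom A B"
    and equivariant: "\<lbrakk>x \<in> carrier A; g \<in> carrier G\<rbrakk> \<Longrightarrow> f (actA x g) = actB (f x) g"

text \<open>In contrast to the library's \<open>short_exact_sequence\<close>, the three groups may have different
  types and the maps are linear over the acting group.\<close>

definition short_exact_gmodules ::
  "('g, 'm) monoid_scheme \<Rightarrow>
   ('a, 'n) monoid_scheme \<Rightarrow> ('a \<Rightarrow> 'g \<Rightarrow> 'a) \<Rightarrow>
   ('b, 'k) monoid_scheme \<Rightarrow> ('b \<Rightarrow> 'g \<Rightarrow> 'b) \<Rightarrow>
   ('c, 'l) monoid_scheme \<Rightarrow> ('c \<Rightarrow> 'g \<Rightarrow> 'c) \<Rightarrow>
   ('a \<Rightarrow> 'b) \<Rightarrow> ('b \<Rightarrow> 'c) \<Rightarrow> bool" where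
  "short_exact_gmodules G A actA B actB C actC f g \<longleftrightarrow>
     right_gmodule_hom G A actA B actB f \<and> right_gmodule_hom G B actB C actC g \<and>
     inj_on f (carrier A) \<and> f ` carrier A = kernel B C g \<and> g ` carrier B = carrier C"


section \<open>The three modules\<close>

text \<open>The actions of \<open>g\<close> on the fundamental group and on the relation module are defined through
  representatives: the union ranges over all \<open>q\<close> in the free group with \<open>\<theta> q = g\<close> and over all
  representatives of the given class, so that it is a single class precisely when the action is
  well defined.\<close>

definition pi1_act ::
  "'x set \<Rightarrow> ('x word \<times> 'x word) set \<Rightarrow> ('x word \<Rightarrow> 'g) \<Rightarrow>
   'x sq_edge path set \<Rightarrow> 'g \<Rightarrow> 'x sq_edge path set" where
  "pi1_act X R \<theta> \<alpha> g =
     (\<Union>q\<in>{q \<in> carrier (free_group X). \<theta> q = g}. \<Union>a\<in>\<alpha>.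
        loop_homotopy (squier_complex X R) [] ``
          {right_whisker X (left_whisker X (inv\<^bsub>free_group X\<^esub> q) a) q})"

text \<open>The additive group of the integral group ring is the free abelian group on the group
  elements. The index set \<open>R\<close> of the direct sum consists of the pairs \<open>(l, r)\<close>.\<close>

definition free_gmodule :: "'i set \<Rightarrow> ('g, 'm) monoid_scheme \<Rightarrow> ('i \<Rightarrow> ('g \<Rightarrow>\<^sub>0 int)) monoid" where
  "free_gmodule I G = sum_group I (\<lambda>_. free_Abelian_group (carrier G))"

definition free_gmodule_act ::
  "'i set \<Rightarrow> ('g, 'm) monoid_scheme \<Rightarrow> ('i \<Rightarrow> ('g \<Rightarrow>\<^sub>0 int)) \<Rightarrow> 'g \<Rightarrow> ('i \<Rightarrow> ('g \<Rightarrow>\<^sub>0 int))" where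
  "free_gmodule_act I G c g = (\<lambda>i\<in>I. frag_extend (\<lambda>h. frag_of (h \<otimes>\<^bsub>G\<^esub> g)) (c i))"

definition abelianization :: "('a, 'b) monoid_scheme \<Rightarrow> 'a set monoid" where
  "abelianization H = H Mod derived H (carrier H)"

abbreviation kernel_group ::
  "'x set \<Rightarrow> ('g, 'm) monoid_scheme \<Rightarrow> ('x word \<Rightarrow> 'g) \<Rightarrow> 'x word monoid" where
  "kernel_group X G \<theta> \<equiv> (free_group X)\<lparr>carrier := kernel (free_group X) G \<theta>\<rparr>"

definition relation_module ::
  "'x set \<Rightarrow> ('g, 'm) monoid_scheme \<Rightarrow> ('x word \<Rightarrow> 'g) \<Rightarrow> 'x word set monoid" where
  "relation_module X G \<theta> = abelianization (kernel_group X G \<theta>)"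

definition relation_module_act ::
  "'x set \<Rightarrow> ('g, 'm) monoid_scheme \<Rightarrow> ('x word \<Rightarrow> 'g) \<Rightarrow> 'x word set \<Rightarrow> 'g \<Rightarrow> 'x word set" where
  "relation_module_act X G \<theta> c g =
     (\<Union>q\<in>{q \<in> carrier (free_group X). \<theta> q = g}. \<Union>n\<in>c.
        derived (kernel_group X G \<theta>) (kernel (free_group X) G \<theta>) #>\<^bsub>kernel_group X G \<theta>\<^esub>
          (inv\<^bsub>free_group X\<^esub> q \<otimes>\<^bsub>free_group X\<^esub> n \<otimes>\<^bsub>free_group X\<^esub> q))"


section \<open>Consistency of the definitions\<close>

lemma inv_letter_inv_letter [simp]: "inv_letter (inv_letter a) = a"
  by (cases a) simp

lemma reduced_tl: "reduced (a # w) \<Longrightarrow> reduced w"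
  by (cases w) auto

lemma reduced_cancel_cons: "reduced w \<Longrightarrow> reduced (cancel_cons a w)"
  by (cases w) (auto dest: reduced_tl)

lemma cancel_cons_inverse:
  assumes "reduced w" shows "cancel_cons a (cancel_cons (inv_letter a) w) = w"
proof (cases w)
  case (Cons b v)
  then show ?thesis using assms by (cases v) auto
qed simp

lemma reduced_foldr: "reduced w \<Longrightarrow> reduced (foldr cancel_cons u w)"
  by (induction u) (auto intro: reduced_cancel_cons)

lemma foldr_cancel_cons:
  assumes "reduced v" "reduced w"
  shows "foldr cancel_cons (cancel_cons a v) w = cancel_cons a (foldr cancel_cons v w)"
proof (cases v)
  case (Cons b v')
  show ?thesis
  proof (cases "b = inv_letter a")
    case True
    then show ?thesis
      using Cons cancel_cons_inverse[OF reduced_foldr[OF assms(2)], of a v'] by simp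
  qed (use Cons in auto)
qed simp

lemma foldr_foldr_cancel_cons:
  assumes "reduced v" "reduced w"
  shows "foldr cancel_cons (foldr cancel_cons u v) w = foldr cancel_cons u (foldr cancel_cons v w)"
  by (induction u) (auto simp: foldr_cancel_cons assms reduced_foldr)

lemma free_reduction_reduced: "reduced w \<Longrightarrow> free_reduction w = w"
  unfolding free_reduction_def
proof (induction w)
  case (Cons a w)
  then show ?case by (cases w) (auto dest: reduced_tl)
qed simp

lemma cancel_cons_words: "a \<in> X \<times> UNIV \<Longrightarrow> w \<in> words X \<Longrightarrow> cancel_cons a w \<in> words X"
  by (cases w) (auto simp: words_def)

lemma foldr_words: "u \<in> words X \<Longrightarrow> w \<in> words X \<Longrightarrow> foldr cancel_cons u w \<in> words X"
proof (induction u)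
  case (Cons a u)
  then have "a \<in> X \<times> UNIV" "u \<in> words X" by (auto simp: words_def)
  then show ?case using Cons by (simp add: cancel_cons_words)
qed simp

lemma free_reduction_in_carrier: "w \<in> words X \<Longrightarrow> free_reduction w \<in> carrier (free_group X)"
  using foldr_words[of w X "[]"]
  by (simp add: free_group_def free_reduction_def reduced_foldr) (simp add: words_def)

lemma free_group_mult_eq:
  "reduced v \<Longrightarrow> u \<otimes>\<^bsub>free_group X\<^esub> v = foldr cancel_cons u v"
  using free_reduction_reduced[of v] by (simp add: free_group_def free_reduction_def)

lemma free_reduction_append:
  "free_reduction (u @ v) = free_reduction u \<otimes>\<^bsub>free_group X\<^esub> free_reduction v"
  by (simp add: free_group_mult_eq free_reduction_def reduced_foldr foldr_foldr_cancel_cons)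

lemma foldr_inverse_word:
  "reduced w \<Longrightarrow> foldr cancel_cons (rev (map inv_letter u)) (foldr cancel_cons u w) = w"
proof (induction u)
  case (Cons a u)
  then show ?case
    using cancel_cons_inverse[of "foldr cancel_cons u w" "inv_letter a"] reduced_foldr[of w u] by simp
qed simp

lemma group_free_group: "group (free_group X)"
proof (rule groupI)
  fix x y assume "x \<in> carrier (free_group X)" "y \<in> carrier (free_group X)"
  then show "x \<otimes>\<^bsub>free_group X\<^esub> y \<in> carrier (free_group X)"
    using free_reduction_in_carrier[of "x @ y" X] by (simp add: free_group_def words_def)
next
  show "\<one>\<^bsub>free_group X\<^esub> \<in> carrier (free_group X)"
    by (simp add: free_group_def words_def)
next
  fix x y z
  assume "x \<in> carrier (free_group X)" "y \<in> carrier (free_group X)" "z \<in> carrier (free_group X)"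
  then have r: "reduced x" "reduced y" "reduced z" by (auto simp: free_group_def)
  then show "x \<otimes>\<^bsub>free_group X\<^esub> y \<otimes>\<^bsub>free_group X\<^esub> z = x \<otimes>\<^bsub>free_group X\<^esub> (y \<otimes>\<^bsub>free_group X\<^esub> z)"
    by (simp add: free_group_mult_eq reduced_foldr foldr_foldr_cancel_cons)
next
  fix x assume "x \<in> carrier (free_group X)"
  then have r: "reduced x" by (simp add: free_group_def)
  then show "\<one>\<^bsub>free_group X\<^esub> \<otimes>\<^bsub>free_group X\<^esub> x = x"
    by (simp add: free_group_mult_eq) (simp add: free_group_def)
next
  fix x assume x: "x \<in> carrier (free_group X)"
  let ?y = "free_reduction (rev (map inv_letter x))"
  have r: "reduced x" and "x \<in> words X" using x by (auto simp: free_group_def)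
  then have "rev (map inv_letter x) \<in> words X" by (fastforce simp: words_def)
  then have "?y \<in> carrier (free_group X)" by (rule free_reduction_in_carrier)
  moreover have "?y \<otimes>\<^bsub>free_group X\<^esub> x = \<one>\<^bsub>free_group X\<^esub>"
    using r foldr_inverse_word[of "[]" x] free_reduction_reduced[OF r]
    by (simp add: free_group_mult_eq free_reduction_def foldr_foldr_cancel_cons)
      (simp add: free_group_def)
  ultimately show "\<exists>y\<in>carrier (free_group X). y \<otimes>\<^bsub>free_group X\<^esub> x = \<one>\<^bsub>free_group X\<^esub>" by blast
qed

lemma (in group) normal_closure_normal:
  assumes "S \<subseteq> carrier G" shows "normal_closure G S \<lhd> G"
proof -
  have c: "carrier G \<lhd> G"
    by (simp add: normal_inv_iff subgroup_self)
  have "subgroup (normal_closure G S) G"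
    unfolding normal_closure_def
  proof (rule subgroups_Inter)
    show "{N. N \<lhd> G \<and> S \<subseteq> N} \<noteq> {}" using c assms by blast
  qed (auto simp: normal_imp_subgroup)
  then show ?thesis
    unfolding normal_inv_iff by (auto simp: normal_closure_def normal_inv_iff)
qed

lemma quotient_is_presentation:
  assumes "R \<subseteq> words X \<times> words X"
  defines "N \<equiv> normal_closure (free_group X) (relators X R)"
  shows "is_presentation X R (free_group X Mod N) (\<lambda>w. N #>\<^bsub>free_group X\<^esub> w)"
proof -
  interpret group "free_group X" by (rule group_free_group)
  have "relators X R \<subseteq> carrier (free_group X)"
    using assms(1) by (auto simp: relators_def intro!: m_closed inv_closed free_reduction_in_carrier)
  then interpret N: normal N "free_group X"
    unfolding N_def by (rule normal_closure_normal)
  have "kernel (free_group X) (free_group X Mod N) (\<lambda>w. N #>\<^bsub>free_group X\<^esub> w) = N"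
    using N.rcos_const N.subset N.is_subgroup coset_join1 rcos_self
    unfolding kernel_def FactGroup_def by force
  moreover have "(\<lambda>w. N #>\<^bsub>free_group X\<^esub> w) \<in> epi (free_group X) (free_group X Mod N)"
    using N.r_coset_hom_Mod by (auto simp: epi_def FactGroup_def RCOSETS_def)
  ultimately show ?thesis
    using assms N.factorgroup_is_group by (simp add: is_presentation_def)
qed

lemma squier_cell_boundary:
  assumes "R \<subseteq> words X \<times> words X" and "(c, d) \<in> cells (squier_complex X R)"
  shows "\<exists>v w. is_path (squier_complex X R) v c w \<and> is_path (squier_complex X R) v d w"
proof -
  interpret group "free_group X" by (rule group_free_group)
  have "\<And>l r. (l, r) \<in> R \<Longrightarrow>
      free_reduction l \<in> carrier (free_group X) \<and> free_reduction r \<in> carrier (free_group X)"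
    using assms(1) free_reduction_in_carrier by blast
  then show ?thesis
    using assms(2) by (fastforce simp: squier_complex_def Let_def m_assoc)
qed

end

theory Submission
  imports Defs
begin

text \<open>An edge \<open>(p, l, r, q)\<close> of the reduced Squier complex is determined by its source and its label
  \<open>(q, (l, r))\<close>, and it multiplies its source on the right by \<open>q\<^sup>-\<^sup>1 l\<^sup>-\<^sup>1 r q\<close>. Hence paths starting at
  \<open>1\<close> are words in the labels, and the 2-cells become the Peiffer relations: homotopy classes of such
  paths form the free crossed module \<open>C\<close> of the presentation, with boundary map \<open>C \<rightarrow> F(X)\<close> of image
  \<open>N\<close> and kernel \<open>K = \<pi>\<^sub>1\<close>. Counting the labels of a path modulo \<open>N\<close> is the abelianization
  \<open>C \<rightarrow> \<Oplus> \<int>G\<close>, and the boundary induces \<open>\<Oplus> \<int>G \<rightarrow> N\<^sup>a\<^sup>b\<close>. Exactness in the middle holds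
  because commutators in \<open>N\<close> lift to commutators in \<open>C\<close>. For injectivity, \<open>K\<close> is central in \<open>C\<close> and
  \<open>C \<rightarrow> N\<close> splits (as \<open>N\<close> is free), so there is a retraction of \<open>C\<close> onto the abelian group \<open>K\<close>; it
  factors through the count, so that a loop of count zero is null-homotopic.\<close>

section \<open>The fundamental group\<close>

text \<open>Sending an edge to its label makes the reduced Squier complex a covering of a one-vertex
  complex with the labels as edges and the Peiffer relations as 2-cells. The fibre is F(X), on which
  a label acts by right multiplication with its boundary. This is why C can be set up as a
  fundamental group itself, and why \<open>\<pi>\<^sub>1\<close> at 1 is the kernel of the boundary.
  The delicate point is that all stages of a homotopy must be loops: downstairs every word is a
  loop, upstairs only the lifts of words with boundary 1 are, so lifting a homotopy has to carry
  this invariant along.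

  The module axioms of the two outer terms are not checked on representatives. Those of
  \<open>\<pi>\<^sub>1\<close> are pulled back along the injective count, those of the relation
  module are pushed forward along the surjection from the free module. Independence of the action on
  \<open>\<pi>\<^sub>1\<close> from representatives also follows from injectivity: the count of a
  conjugated loop sees the conjugating element only modulo N.\<close>

definition inv_path :: "'e path \<Rightarrow> 'e path" where
  "inv_path p = rev (map (\<lambda>(e, s). (e, \<not> s)) p)"

lemma inv_path_Nil [simp]: "inv_path [] = []"
  by (simp add: inv_path_def)

lemma inv_path_Cons [simp]: "inv_path ((e, s) # p) = inv_path p @ [(e, \<not> s)]"
  by (simp add: inv_path_def)

lemma inv_path_append: "inv_path (p @ q) = inv_path q @ inv_path p"
  by (simp add: inv_path_def)

lemma inv_path_inv_path [simp]: "inv_path (inv_path p) = p"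
  by (induction p) (auto simp: inv_path_append)

lemma is_path_verts: "is_path K v p w \<Longrightarrow> v \<in> verts K \<and> w \<in> verts K"
  by (induction p arbitrary: v) auto

lemma is_path_append: "is_path K v (p @ q) w \<longleftrightarrow> (\<exists>u. is_path K v p u \<and> is_path K u q w)"
proof (induction p arbitrary: v)
  case Nil
  then show ?case by (auto dest: is_path_verts)
next
  case (Cons x p)
  obtain e s where x: "x = (e, s)" by force
  show ?case by (simp only: x append_Cons is_path.simps Cons.IH) blast
qed

lemma is_path_inv_path: "is_path K v p w \<Longrightarrow> is_path K w (inv_path p) v"
proof (induction p arbitrary: v)
  case (Cons x p)
  obtain e s where x: "x = (e, s)" by force
  let ?u = "if s then tgt K e else src K e"
  have "is_path K ?u p w" using Cons.prems x by simp
  then have "is_path K w (inv_path p) ?u" "?u \<in> verts K"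
    by (rule Cons.IH, rule is_path_verts[THEN conjunct1])
  moreover have "is_path K ?u [(e, \<not> s)] v" using Cons.prems x calculation(2) by auto
  ultimately show ?case unfolding x inv_path_Cons is_path_append by (intro exI conjI)
qed auto

lemma is_path_edges: "is_path K v p w \<Longrightarrow> fst ` set p \<subseteq> edges K"
proof (induction p arbitrary: v)
  case (Cons x p)
  obtain e s where x: "x = (e, s)" by force
  have "is_path K (if s then tgt K e else src K e) p w" "e \<in> edges K" using Cons.prems x by auto
  from Cons.IH[OF this(1)] this(2) show ?case by (simp add: x)
qed auto

lemma loops_append: "p \<in> loops K v \<Longrightarrow> q \<in> loops K v \<Longrightarrow> p @ q \<in> loops K v"
  by (auto simp: loops_def is_path_append)

lemma loops_inv_path: "p \<in> loops K v \<Longrightarrow> inv_path p \<in> loops K v"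
  by (simp add: loops_def is_path_inv_path)

lemma append_inv_path_loop: "is_path K v p w \<Longrightarrow> p @ inv_path p \<in> loops K v"
  unfolding loops_def mem_Collect_eq is_path_append by (intro exI conjI is_path_inv_path)

lemma loops_edges: "p \<in> loops K v \<Longrightarrow> fst ` set p \<subseteq> edges K"
  by (simp add: loops_def is_path_edges)

lemma equiv_loop_homotopy: "equiv (loops K v) (loop_homotopy K v)"
  by (rule equivI)
    (auto simp: loop_homotopy_def refl_on_def sym_def trans_def
      intro: equivclp_sym equivclp_trans)

lemma loop_homotopy_refl: "p \<in> loops K v \<Longrightarrow> (p, p) \<in> loop_homotopy K v"
  by (simp add: loop_homotopy_def)

lemma loop_homotopy_trans:
  "(p, q) \<in> loop_homotopy K v \<Longrightarrow> (q, r) \<in> loop_homotopy K v \<Longrightarrow> (p, r) \<in> loop_homotopy K v"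
  using equiv_loop_homotopy[of K v] by (meson equivE transE)

lemma homotopy_step_append:
  assumes "homotopy_step K a b" shows "homotopy_step K (x @ a @ y) (x @ b @ y)"
  using assms
proof cases
  case (backtrack p e s q)
  then show ?thesis using homotopy_step.backtrack[of K "x @ p" e s "q @ y"] by simp
next
  case (cell c d p q)
  then show ?thesis using homotopy_step.cell[of c d K "x @ p" "q @ y"] by simp
qed

text \<open>The invariant \<open>Q\<close> restricts the homotopy to those loops of \<open>K\<close>
  that \<open>f\<close> sends to loops of \<open>L\<close>. It is trivial for concatenation, and is
  the condition of trivial boundary when words are lifted to the Squier complex.\<close>

lemma loop_homotopy_map:
  assumes ab: "(a, b) \<in> loop_homotopy K v" and "Q a"
    and inv: "\<And>x y. x \<in> loops K v \<Longrightarrow> y \<in> loops K v \<Longrightarrow> homotopy_step K x y \<Longrightarrow> Q x = Q y"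
    and loop: "\<And>x. x \<in> loops K v \<Longrightarrow> Q x \<Longrightarrow> f x \<in> loops L w"
    and step: "\<And>x y. x \<in> loops K v \<Longrightarrow> y \<in> loops K v \<Longrightarrow> Q x \<Longrightarrow> homotopy_step K x y \<Longrightarrow>
      homotopy_step L (f x) (f y)"
  shows "(f a, f b) \<in> loop_homotopy L w"
proof -
  have "equivclp (\<lambda>a b. a \<in> loops K v \<and> b \<in> loops K v \<and> homotopy_step K a b) a b"
    using ab by (simp add: loop_homotopy_def)
  then have "Q b \<and> equivclp (\<lambda>a b. a \<in> loops L w \<and> b \<in> loops L w \<and> homotopy_step L a b) (f a) (f b)"
  proof induction
    case (step y z)
    then have yz: "y \<in> loops K v" "z \<in> loops K v" "homotopy_step K y z \<or> homotopy_step K z y"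
      by auto
    then have Q: "Q y" "Q z" using step.IH inv[of y z] inv[of z y] by blast+
    then have "homotopy_step L (f y) (f z) \<or> homotopy_step L (f z) (f y)"
      using yz assms(5)[of y z] assms(5)[of z y] by blast
    then have "equivclp (\<lambda>a b. a \<in> loops L w \<and> b \<in> loops L w \<and> homotopy_step L a b) (f a) (f z)"
      using loop[OF yz(1) Q(1)] loop[OF yz(2) Q(2)]
      by (intro equivclp_into_equivclp[OF step.IH[THEN conjunct2]]) simp
    with Q show ?case by simp
  qed (simp add: \<open>Q a\<close>)
  moreover have "a \<in> loops K v" "b \<in> loops K v" using ab by (simp_all add: loop_homotopy_def)
  ultimately show ?thesis using loop \<open>Q a\<close> by (simp add: loop_homotopy_def)
qed

lemma loop_homotopy_append:
  assumes "(a, b) \<in> loop_homotopy K v" "(c, d) \<in> loop_homotopy K v"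
  shows "(a @ c, b @ d) \<in> loop_homotopy K v"
proof -
  have loops: "b \<in> loops K v" "c \<in> loops K v" using assms by (auto simp: loop_homotopy_def)
  have "(a @ c, b @ c) \<in> loop_homotopy K v"
    using assms(1)
  proof (rule loop_homotopy_map[where Q = "\<lambda>_. True"])
    show "homotopy_step K (x @ c) (y @ c)" if "homotopy_step K x y" for x y
      using homotopy_step_append[OF that, of "[]" c] by simp
  qed (use loops in \<open>auto intro: loops_append\<close>)
  moreover have "(b @ c, b @ d) \<in> loop_homotopy K v"
    using assms(2)
  proof (rule loop_homotopy_map[where Q = "\<lambda>_. True"])
    show "homotopy_step K (b @ x) (b @ y)" if "homotopy_step K x y" for x y
      using homotopy_step_append[OF that, of b "[]"] by simp
  qed (use loops in \<open>auto intro: loops_append\<close>)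
  ultimately show ?thesis by (rule loop_homotopy_trans)
qed

lemma append_inv_path_homotopic:
  assumes "is_path K v p w" shows "(p @ inv_path p, []) \<in> loop_homotopy K v"
  using assms
\<comment> \<open>Induction from the right end: the last edge of \<open>p\<close> meets its inverse
  in the middle of \<open>p @ inv_path p\<close>, so one backtracking step removes it.\<close>
proof (induction p arbitrary: w rule: rev_induct)
  case Nil
  then show ?case by (auto simp: loop_homotopy_def loops_def)
next
  case (snoc x p)
  obtain e s where x: "x = (e, s)" by force
  obtain u where u: "is_path K v p u" using snoc.prems by (auto simp: is_path_append)
  have "(p @ [x]) @ inv_path (p @ [x]) \<in> loops K v" "p @ inv_path p \<in> loops K v"
    using snoc.prems u by (blast intro: append_inv_path_loop)+
  moreover have "homotopy_step K ((p @ [x]) @ inv_path (p @ [x])) (p @ inv_path p)"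
    using homotopy_step.backtrack[of K p e s "inv_path p"] by (simp add: x inv_path_append)
  ultimately have "((p @ [x]) @ inv_path (p @ [x]), p @ inv_path p) \<in> loop_homotopy K v"
    by (auto simp: loop_homotopy_def)
  then show ?case using snoc.IH[OF u] by (rule loop_homotopy_trans)
qed

abbreviation loop_class :: "('v, 'e) two_complex \<Rightarrow> 'v \<Rightarrow> 'e path \<Rightarrow> 'e path set" where
  "loop_class K v p \<equiv> loop_homotopy K v `` {p}"

lemma loop_class_eq_iff:
  "p \<in> loops K v \<Longrightarrow> q \<in> loops K v \<Longrightarrow>
    loop_class K v p = loop_class K v q \<longleftrightarrow> (p, q) \<in> loop_homotopy K v"
  using eq_equiv_class_iff[OF equiv_loop_homotopy] .

lemma fundamental_group_carrier:
  "carrier (fundamental_group K v) = loop_class K v ` loops K v"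
  by (auto simp: fundamental_group_def quotient_def)

lemma fundamental_group_one: "\<one>\<^bsub>fundamental_group K v\<^esub> = loop_class K v []"
  by (simp add: fundamental_group_def)

lemma fundamental_group_mult:
  assumes "p \<in> loops K v" "q \<in> loops K v"
  shows "loop_class K v p \<otimes>\<^bsub>fundamental_group K v\<^esub> loop_class K v q = loop_class K v (p @ q)"
proof -
  have "loop_class K v (a @ b) = loop_class K v (p @ q)"
    if "a \<in> loop_class K v p" "b \<in> loop_class K v q" for a b
  proof -
    have "(p @ q, a @ b) \<in> loop_homotopy K v"
      using that by (intro loop_homotopy_append) simp_all
    then show ?thesis by (rule equiv_class_eq[OF equiv_loop_homotopy, symmetric])
  qed
  moreover have "p \<in> loop_class K v p" "q \<in> loop_class K v q"
    using assms by (simp_all add: loop_homotopy_refl)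
  ultimately have "(\<Union>a\<in>loop_class K v p. \<Union>b\<in>loop_class K v q. loop_class K v (a @ b)) =
      loop_class K v (p @ q)"
    by blast
  then show ?thesis by (simp add: fundamental_group_def)
qed

lemma group_fundamental_group:
  assumes "v \<in> verts K" shows "group (fundamental_group K v)"
proof (rule groupI)
  have nil: "[] \<in> loops K v" using assms by (simp add: loops_def)
  then show "\<one>\<^bsub>fundamental_group K v\<^esub> \<in> carrier (fundamental_group K v)"
    by (auto simp: fundamental_group_carrier fundamental_group_one)
  fix x assume "x \<in> carrier (fundamental_group K v)"
  then obtain p where p: "p \<in> loops K v" "x = loop_class K v p"
    by (auto simp: fundamental_group_carrier)
  then show "\<one>\<^bsub>fundamental_group K v\<^esub> \<otimes>\<^bsub>fundamental_group K v\<^esub> x = x"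
    using nil by (simp add: fundamental_group_one fundamental_group_mult)
  have "(inv_path p @ p, []) \<in> loop_homotopy K v"
    using append_inv_path_homotopic[of K v "inv_path p" v] loops_inv_path[OF p(1)]
    by (simp add: loops_def)
  then show "\<exists>y\<in>carrier (fundamental_group K v). y \<otimes>\<^bsub>fundamental_group K v\<^esub> x = \<one>\<^bsub>fundamental_group K v\<^esub>"
    using p nil loops_inv_path[OF p(1)]
    by (intro bexI[of _ "loop_class K v (inv_path p)"])
      (auto simp: fundamental_group_one fundamental_group_mult fundamental_group_carrier
        loop_class_eq_iff loops_append)
  fix y assume "y \<in> carrier (fundamental_group K v)"
  then obtain q where q: "q \<in> loops K v" "y = loop_class K v q"
    by (auto simp: fundamental_group_carrier)
  show "x \<otimes>\<^bsub>fundamental_group K v\<^esub> y \<in> carrier (fundamental_group K v)"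
    using p q by (auto simp: fundamental_group_mult fundamental_group_carrier loops_append)
  fix z assume "z \<in> carrier (fundamental_group K v)"
  then obtain r where r: "r \<in> loops K v" "z = loop_class K v r"
    by (auto simp: fundamental_group_carrier)
  show "x \<otimes>\<^bsub>fundamental_group K v\<^esub> y \<otimes>\<^bsub>fundamental_group K v\<^esub> z =
      x \<otimes>\<^bsub>fundamental_group K v\<^esub> (y \<otimes>\<^bsub>fundamental_group K v\<^esub> z)"
    using p q r by (simp add: fundamental_group_mult loops_append)
qed

section \<open>Evaluating paths and homotopy classes in a group\<close>

context group
begin

fun signed :: "'a \<Rightarrow> bool \<Rightarrow> 'a" where
  "signed x s = (if s then x else inv x)"

lemma signed_closed: "x \<in> carrier G \<Longrightarrow> signed x s \<in> carrier G"
  by simp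

fun path_value :: "('e \<Rightarrow> 'a) \<Rightarrow> 'e path \<Rightarrow> 'a" where
  "path_value f [] = \<one>"
| "path_value f ((e, s) # p) = signed (f e) s \<otimes> path_value f p"

lemma path_value_closed:
  "fst ` set p \<subseteq> E \<Longrightarrow> f \<in> E \<rightarrow> carrier G \<Longrightarrow> path_value f p \<in> carrier G"
  by (induction p) (auto intro!: m_closed simp: Pi_iff)

lemma path_value_append:
  "fst ` set p \<subseteq> E \<Longrightarrow> fst ` set q \<subseteq> E \<Longrightarrow> f \<in> E \<rightarrow> carrier G \<Longrightarrow>
    path_value f (p @ q) = path_value f p \<otimes> path_value f q"
proof (induction p)
  case (Cons x p)
  from Cons.prems have "f (fst x) \<in> carrier G" "path_value f p \<in> carrier G" "path_value f q \<in> carrier G"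
    by (auto simp: path_value_closed)
  with Cons show ?case by (cases x) (auto simp: m_assoc)
qed (simp add: path_value_closed)

lemma path_value_hom:
  assumes "group H" "h \<in> hom G H" "fst ` set p \<subseteq> E" "f \<in> E \<rightarrow> carrier G"
  shows "h (path_value f p) = group.path_value H (\<lambda>e. h (f e)) p"
proof -
  interpret h: group_hom G H h by (simp add: assms group_hom_def group_hom_axioms_def)
  show ?thesis
    using assms(3)
  proof (induction p)
    case (Cons x p)
    moreover have "path_value f p \<in> carrier G" "f (fst x) \<in> carrier G"
      using Cons.prems assms(4) by (auto simp: path_value_closed)
    ultimately show ?case by (cases x) simp
  qed simp
qed

lemma path_value_map:
  "path_value f (map (\<lambda>(e, s). (g e, s)) p) = path_value (\<lambda>e. f (g e)) p"
  by (induction p) auto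

lemma path_value_cong:
  "fst ` set p \<subseteq> E \<Longrightarrow> (\<And>e. e \<in> E \<Longrightarrow> f e = g e) \<Longrightarrow> path_value f p = path_value g p"
  by (induction p) auto

text \<open>Backtracking cancels in any group, so only the 2-cells impose conditions. The boundary,
  the count and the map \<phi> out of the fundamental groups are all obtained in this way.\<close>

lemma path_value_loop_homotopy:
  assumes f: "f \<in> edges K \<rightarrow> carrier G"
    and cells: "\<And>c d. (c, d) \<in> cells K \<Longrightarrow> path_value f c = path_value f d"
    and ab: "(a, b) \<in> loop_homotopy K v"
  shows "path_value f a = path_value f b"
proof -
  note E = loops_edges[of _ K v]
  have inv: "path_value f a = path_value f b"
    if "a \<in> loops K v" "b \<in> loops K v" "homotopy_step K a b" for a b
    using that(3)
  proof cases
    case (backtrack p e s q)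
    then have "fst ` set p \<subseteq> edges K" "fst ` set q \<subseteq> edges K" "e \<in> edges K"
      using E[OF that(1)] by auto
    moreover from this have "f e \<in> carrier G" "path_value f q \<in> carrier G"
      using f by (auto intro: path_value_closed)
    ultimately show ?thesis
      using f unfolding backtrack by (simp add: path_value_append[of _ "edges K"] m_assoc[symmetric])
  next
    case (cell c d p q)
    then have "fst ` set p \<subseteq> edges K" "fst ` set q \<subseteq> edges K" "fst ` set c \<subseteq> edges K"
        "fst ` set d \<subseteq> edges K"
      using E[OF that(1)] E[OF that(2)] by auto
    then show ?thesis
      using f cells[OF cell(3)] unfolding cell(1,2)
      by (simp add: image_Un path_value_append[of _ "edges K"])
  qed
  have "equivclp (\<lambda>a b. a \<in> loops K v \<and> b \<in> loops K v \<and> homotopy_step K a b) a b"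
    using ab by (simp add: loop_homotopy_def)
  then show ?thesis
  proof induction
    case (step y z)
    then show ?case using inv[of y z] inv[of z y] by metis
  qed simp
qed

text \<open>Choosing a representative keeps the complex and the base point out of the definition;
  the value is independent of the choice as soon as \<open>f\<close> respects the 2-cells.\<close>

definition class_value :: "('e \<Rightarrow> 'a) \<Rightarrow> 'e path set \<Rightarrow> 'a" where
  "class_value f \<alpha> = path_value f (SOME p. p \<in> \<alpha>)"

lemma class_value_loop_class:
  assumes "f \<in> edges K \<rightarrow> carrier G"
    and "\<And>c d. (c, d) \<in> cells K \<Longrightarrow> path_value f c = path_value f d"
    and "p \<in> loops K v"
  shows "class_value f (loop_class K v p) = path_value f p"
proof -
  have "(SOME q. q \<in> loop_class K v p) \<in> loop_class K v p"
    using equiv_class_self[OF equiv_loop_homotopy assms(3)] by (rule someI)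
  then have "(p, SOME q. q \<in> loop_class K v p) \<in> loop_homotopy K v" by blast
  from path_value_loop_homotopy[OF assms(1,2) this] show ?thesis
    by (simp add: class_value_def)
qed

lemma class_value_hom:
  assumes "f \<in> edges K \<rightarrow> carrier G"
    and "\<And>c d. (c, d) \<in> cells K \<Longrightarrow> path_value f c = path_value f d"
  shows "class_value f \<in> hom (fundamental_group K v) G"
proof (rule homI)
  note E = loops_edges[of _ K v]
  fix x assume "x \<in> carrier (fundamental_group K v)"
  then obtain p where p: "p \<in> loops K v" "x = loop_class K v p"
    by (auto simp: fundamental_group_carrier)
  then show "class_value f x \<in> carrier G"
    using assms E by (simp add: class_value_loop_class path_value_closed[of _ "edges K"])
  fix y assume "y \<in> carrier (fundamental_group K v)"
  then obtain q where q: "q \<in> loops K v" "y = loop_class K v q"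
    by (auto simp: fundamental_group_carrier)
  show "class_value f (x \<otimes>\<^bsub>fundamental_group K v\<^esub> y) = class_value f x \<otimes> class_value f y"
    using p q assms(1) E
    by (simp add: fundamental_group_mult class_value_loop_class[OF assms] loops_append
        path_value_append[of _ "edges K"])
qed

end

section \<open>Modules over a group\<close>

text \<open>Commutativity of \<open>A\<close> and the module axioms are equations, which may be
  tested after applying the injective equivariant map \<open>f\<close>. Meant for the fundamental
  group, whose action is hard to compute with directly.\<close>

lemma right_gmodule_hom_inj:
  assumes B: "right_gmodule G B actB" and A: "group A"
    and f: "f \<in> hom A B" and inj: "inj_on f (carrier A)"
    and closed: "\<And>x g. x \<in> carrier A \<Longrightarrow> g \<in> carrier G \<Longrightarrow> actA x g \<in> carrier A"
    and equivariant: "\<And>x g. x \<in> carrier A \<Longrightarrow> g \<in> carrier G \<Longrightarrow> f (actA x g) = actB (f x) g"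
  shows "right_gmodule_hom G A actA B actB f"
proof -
  interpret B: right_gmodule G B actB by (fact B)
  interpret A: group A by (fact A)
  note [simp] = hom_in_carrier[OF f] hom_mult[OF f] closed equivariant
  have eq: "x = y" if "f x = f y" "x \<in> carrier A" "y \<in> carrier A" for x y
    using that inj by (simp add: inj_on_eq_iff)
  have "comm_group A"
    by (rule A.group_comm_groupI) (rule eq, auto simp: B.M.m_comm)
  moreover have "right_gmodule_axioms G A actA"
  proof
    fix g assume g: "g \<in> carrier G"
    show "(\<lambda>x. actA x g) \<in> hom A A"
      using g by (intro homI) (auto intro!: eq simp: hom_mult[OF B.act_hom[OF g]])
  next
    fix x assume "x \<in> carrier A" then show "actA x \<one>\<^bsub>G\<^esub> = x"
      by (intro eq) (auto simp: B.act_one)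
  next
    fix x g h assume "x \<in> carrier A" "g \<in> carrier G" "h \<in> carrier G"
    then show "actA x (g \<otimes>\<^bsub>G\<^esub> h) = actA (actA x g) h"
      by (intro eq) (auto simp: B.act_mult)
  qed
  ultimately have "right_gmodule G A actA"
    by (simp add: right_gmodule_def B.G.group_axioms)
  then show ?thesis
    using B f equivariant by (simp add: right_gmodule_hom_def right_gmodule_hom_axioms_def)
qed

text \<open>Dual transport: every element of \<open>C\<close> is an image, so the axioms of the
  action on \<open>C\<close> are images of those on \<open>B\<close>. Meant for the relation
  module.\<close>

lemma right_gmodule_hom_surj:
  assumes B: "right_gmodule G B actB" and C: "comm_group C"
    and f: "f \<in> hom B C" and surj: "f ` carrier B = carrier C"
    and equivariant: "\<And>x g. x \<in> carrier B \<Longrightarrow> g \<in> carrier G \<Longrightarrow> f (actB x g) = actC (f x) g"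
  shows "right_gmodule_hom G B actB C actC f"
proof -
  interpret B: right_gmodule G B actB by (fact B)
  interpret C: comm_group C by (fact C)
  note [simp] = hom_in_carrier[OF f]
  have closed [simp]: "actB x g \<in> carrier B" if "x \<in> carrier B" "g \<in> carrier G" for x g
    using hom_in_carrier[OF B.act_hom[OF that(2)] that(1)] .
  have "right_gmodule_axioms G C actC"
  proof
    fix g assume g: "g \<in> carrier G"
    show "(\<lambda>x. actC x g) \<in> hom C C"
    proof (rule homI)
      fix x assume "x \<in> carrier C"
      then obtain a where a: "a \<in> carrier B" "x = f a" using surj by blast
      then show "actC x g \<in> carrier C" using g by (simp flip: equivariant)
      fix y assume "y \<in> carrier C"
      then obtain b where b: "b \<in> carrier B" "y = f b" using surj by blast
      show "actC (x \<otimes>\<^bsub>C\<^esub> y) g = actC x g \<otimes>\<^bsub>C\<^esub> actC y g"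
        using a b g by (simp flip: equivariant hom_mult[OF f] hom_mult[OF B.act_hom[OF g]])
    qed
  next
    fix x assume "x \<in> carrier C"
    then obtain a where "a \<in> carrier B" "x = f a" using surj by blast
    then show "actC x \<one>\<^bsub>G\<^esub> = x" by (simp add: B.act_one flip: equivariant)
  next
    fix x g h assume gh: "x \<in> carrier C" "g \<in> carrier G" "h \<in> carrier G"
    then obtain a where "a \<in> carrier B" "x = f a" using surj by blast
    then show "actC x (g \<otimes>\<^bsub>G\<^esub> h) = actC (actC x g) h"
      using gh by (simp add: B.act_mult flip: equivariant)
  qed
  then have "right_gmodule G C actC"
    by (simp add: right_gmodule_def B.G.group_axioms C)
  then show ?thesis
    using B f equivariant by (simp add: right_gmodule_hom_def right_gmodule_hom_axioms_def)
qed

text \<open>Elements of the direct sum are extensional functions, so the value outside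
  \<open>I\<close> is the undefined one and not 0.\<close>

definition free_single :: "'i set \<Rightarrow> 'i \<Rightarrow> ('g \<Rightarrow>\<^sub>0 int) \<Rightarrow> 'i \<Rightarrow> ('g \<Rightarrow>\<^sub>0 int)" where
  "free_single I i c = (\<lambda>j\<in>I. if j = i then c else 0)"

abbreviation free_basis :: "'i set \<Rightarrow> 'i \<Rightarrow> 'g \<Rightarrow> 'i \<Rightarrow> ('g \<Rightarrow>\<^sub>0 int)" where
  "free_basis I i g \<equiv> free_single I i (frag_of g)"

lemma free_gmodule_carrier:
  "carrier (free_gmodule I G) =
    {x \<in> extensional I. (\<forall>i\<in>I. Poly_Mapping.keys (x i) \<subseteq> carrier G) \<and> finite {i \<in> I. x i \<noteq> 0}}"
  by (auto simp: free_gmodule_def carrier_sum_group PiE_iff)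

lemma free_gmodule_mult:
  "x \<otimes>\<^bsub>free_gmodule I G\<^esub> y = (\<lambda>i\<in>I. x i + y i)"
  by (simp add: free_gmodule_def)

lemma free_gmodule_one: "\<one>\<^bsub>free_gmodule I G\<^esub> = (\<lambda>i\<in>I. 0)"
  by (simp add: free_gmodule_def)

lemma group_free_gmodule: "group (free_gmodule I G)"
  by (simp add: free_gmodule_def)

lemma free_gmodule_inv:
  "x \<in> carrier (free_gmodule I G) \<Longrightarrow> inv\<^bsub>free_gmodule I G\<^esub> x = (\<lambda>i\<in>I. - x i)"
  using inv_sum_group[of I "\<lambda>_. free_Abelian_group (carrier G)" x]
  by (auto simp: free_gmodule_def carrier_sum_group PiE_iff fun_eq_iff)

lemma comm_group_free_gmodule: "comm_group (free_gmodule I G)"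
  by (rule group.group_comm_groupI[OF group_free_gmodule]) (simp add: free_gmodule_mult add.commute)

lemma free_single_closed:
  "Poly_Mapping.keys c \<subseteq> carrier G \<Longrightarrow> free_single I i c \<in> carrier (free_gmodule I G)"
  by (auto simp: free_gmodule_carrier free_single_def intro: finite_subset[of _ "{i}"])

lemma keys_frag_extend_translate:
  assumes "group G" "Poly_Mapping.keys c \<subseteq> carrier G" "g \<in> carrier G"
  shows "Poly_Mapping.keys (frag_extend (\<lambda>h. frag_of (h \<otimes>\<^bsub>G\<^esub> g)) c) \<subseteq> carrier G"
proof -
  interpret group G by fact
  show ?thesis using keys_frag_extend[of "\<lambda>h. frag_of (h \<otimes>\<^bsub>G\<^esub> g)" c] assms(2,3) by force
qed

lemma right_gmodule_free_gmodule:
  assumes "group G" shows "right_gmodule G (free_gmodule I G) (free_gmodule_act I G)"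
proof -
  interpret group G by fact
  interpret M: comm_group "free_gmodule I G" by (rule comm_group_free_gmodule)
  have closed: "free_gmodule_act I G x g \<in> carrier (free_gmodule I G)"
    if x: "x \<in> carrier (free_gmodule I G)" and g: "g \<in> carrier G" for x g
  proof -
    have "{i \<in> I. free_gmodule_act I G x g i \<noteq> 0} \<subseteq> {i \<in> I. x i \<noteq> 0}"
      by (auto simp: free_gmodule_act_def)
    moreover have "finite {i \<in> I. x i \<noteq> 0}" using x by (simp add: free_gmodule_carrier)
    ultimately have "finite {i \<in> I. free_gmodule_act I G x g i \<noteq> 0}" by (rule finite_subset)
    moreover have "Poly_Mapping.keys (free_gmodule_act I G x g i) \<subseteq> carrier G" if "i \<in> I" for i
      using x g that keys_frag_extend_translate[OF assms, of "x i" g]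
      by (simp add: free_gmodule_carrier free_gmodule_act_def)
    ultimately show ?thesis by (simp add: free_gmodule_carrier free_gmodule_act_def)
  qed
  show ?thesis
  proof
    fix g assume g: "g \<in> carrier G"
    show "(\<lambda>x. free_gmodule_act I G x g) \<in> hom (free_gmodule I G) (free_gmodule I G)"
      using g by (intro homI closed)
        (auto simp: free_gmodule_mult free_gmodule_act_def frag_extend_add fun_eq_iff)
  next
    fix x assume x: "x \<in> carrier (free_gmodule I G)"
    have "frag_extend (\<lambda>h. frag_of (h \<otimes>\<^bsub>G\<^esub> \<one>\<^bsub>G\<^esub>)) (x i) = x i" if "i \<in> I" for i
    proof -
      have "frag_extend (\<lambda>h. frag_of (h \<otimes>\<^bsub>G\<^esub> \<one>\<^bsub>G\<^esub>)) (x i) = frag_extend frag_of (x i)"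
        using x that by (intro frag_extend_eq) (auto simp: free_gmodule_carrier subset_iff)
      then show ?thesis by (simp flip: frag_expansion)
    qed
    then show "free_gmodule_act I G x \<one>\<^bsub>G\<^esub> = x"
      using x by (auto simp: free_gmodule_act_def free_gmodule_carrier extensional_def)
  next
    fix x g h assume x: "x \<in> carrier (free_gmodule I G)" and gh: "g \<in> carrier G" "h \<in> carrier G"
    have "frag_extend (\<lambda>k. frag_of (k \<otimes>\<^bsub>G\<^esub> (g \<otimes>\<^bsub>G\<^esub> h))) (x i) =
        frag_extend (\<lambda>k. frag_of (k \<otimes>\<^bsub>G\<^esub> h)) (frag_extend (\<lambda>k. frag_of (k \<otimes>\<^bsub>G\<^esub> g)) (x i))"
      if "i \<in> I" for i
    proof -
      have "frag_extend (\<lambda>k. frag_of (k \<otimes>\<^bsub>G\<^esub> h)) (frag_extend (\<lambda>k. frag_of (k \<otimes>\<^bsub>G\<^esub> g)) (x i)) =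
          frag_extend (\<lambda>k. frag_of (k \<otimes>\<^bsub>G\<^esub> g \<otimes>\<^bsub>G\<^esub> h)) (x i)"
        using frag_extend_compose[of "\<lambda>k. frag_of (k \<otimes>\<^bsub>G\<^esub> h)" "\<lambda>k. k \<otimes>\<^bsub>G\<^esub> g" "x i"]
        by (simp add: o_def)
      also have "\<dots> = frag_extend (\<lambda>k. frag_of (k \<otimes>\<^bsub>G\<^esub> (g \<otimes>\<^bsub>G\<^esub> h))) (x i)"
        using x gh that by (intro frag_extend_eq) (auto simp: free_gmodule_carrier m_assoc subset_iff)
      finally show ?thesis by simp
    qed
    then show "free_gmodule_act I G x (g \<otimes>\<^bsub>G\<^esub> h) = free_gmodule_act I G (free_gmodule_act I G x g) h"
      by (auto simp: free_gmodule_act_def fun_eq_iff)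
  qed
qed

lemma free_gmodule_act_basis:
  "free_gmodule_act I G (free_basis I i h) g = free_basis I i (h \<otimes>\<^bsub>G\<^esub> g)"
  by (auto simp: free_gmodule_act_def free_single_def fun_eq_iff)

text \<open>The basis generates the direct sum as an abelian group: an element is a finite sum of
  single coordinates, and each of these is an integer combination of group elements. This is how
  \<open>count\<close> is seen to be onto.\<close>

lemma subgroup_free_gmodule_eq_carrier:
  fixes G :: "('g, 'm) monoid_scheme"
  assumes H: "subgroup H (free_gmodule I G)"
    and basis: "\<And>i g. i \<in> I \<Longrightarrow> g \<in> carrier G \<Longrightarrow> free_basis I i g \<in> H"
  shows "H = carrier (free_gmodule I G)"
proof -
  interpret M: comm_group "free_gmodule I G" by (rule comm_group_free_gmodule)
  interpret H: subgroup H "free_gmodule I G" by (fact H)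
  have single: "free_single I i c \<in> H" if c: "Poly_Mapping.keys c \<subseteq> carrier G" and i: "i \<in> I" for i c
  proof (rule free_Abelian_group_induct[OF c])
    show "free_single I i 0 \<in> H" using H.one_closed by (simp add: free_gmodule_one free_single_def)
  next
    fix x y :: "'g \<Rightarrow>\<^sub>0 int"
    assume 2: "Poly_Mapping.keys x \<subseteq> carrier G" "Poly_Mapping.keys y \<subseteq> carrier G"
      "free_single I i x \<in> H" "free_single I i y \<in> H"
    have "free_single I i (x - y) =
        free_single I i x \<otimes>\<^bsub>free_gmodule I G\<^esub> inv\<^bsub>free_gmodule I G\<^esub> free_single I i y"
      using 2 by (auto simp: free_gmodule_inv free_single_closed free_gmodule_mult)
        (auto simp: free_single_def fun_eq_iff)
    then show "free_single I i (x - y) \<in> H" using 2 by simp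
  qed (use basis i in auto)
  \<comment> \<open>Induction on the support; one coordinate is split off by overwriting it with
    0.\<close>
  have "x \<in> H" if "finite S" "x \<in> carrier (free_gmodule I G)" "{i \<in> I. x i \<noteq> 0} = S" for x S
    using that
  proof (induction S arbitrary: x rule: finite_induct)
    case empty
    then have "x = \<one>\<^bsub>free_gmodule I G\<^esub>"
      by (auto simp: free_gmodule_one free_gmodule_carrier extensional_def fun_eq_iff)
    then show ?case by simp
  next
    case (insert i S)
    let ?y = "x(i := 0)"
    have i: "i \<in> I" and x: "x i \<noteq> 0" using insert.prems by blast+
    have S: "{j \<in> I. ?y j \<noteq> 0} = S" using insert.prems(2) insert.hyps(2) by (auto split: if_splits)
    have "?y \<in> carrier (free_gmodule I G)"
      using insert.prems(1) i insert.hyps(1)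
      by (auto simp: free_gmodule_carrier S[simplified] extensional_def)
    then have "?y \<in> H" using S by (rule insert.IH)
    moreover have "free_single I i (x i) \<in> H"
      using insert.prems(1) i by (intro single) (auto simp: free_gmodule_carrier)
    moreover have "x = free_single I i (x i) \<otimes>\<^bsub>free_gmodule I G\<^esub> ?y"
      using insert.prems(1)
      by (auto simp: free_gmodule_mult free_single_def free_gmodule_carrier extensional_def fun_eq_iff)
    ultimately show ?case by (metis H.m_closed)
  qed
  then show ?thesis using H.subset by (force simp: free_gmodule_carrier)
qed

text \<open>Universal property as an abelian group, with basis the pairs of an index and a group
  element. It is stated without actions, since it has to provide maps into \<open>K\<close> as well
  as into the relation module.\<close>

lemma free_gmodule_universal:
  assumes "comm_group A" and f: "\<And>i g. i \<in> I \<Longrightarrow> g \<in> carrier G \<Longrightarrow> f i g \<in> carrier A"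
  obtains h where "h \<in> hom (free_gmodule I G) A"
    "\<And>i g. i \<in> I \<Longrightarrow> g \<in> carrier G \<Longrightarrow> h (free_basis I i g) = f i g"
proof -
  interpret A: comm_group A by fact
  have "\<exists>h. h \<in> hom (free_Abelian_group (carrier G)) A \<and> (\<forall>g\<in>carrier G. h (frag_of g) = f i g)"
    if "i \<in> I" for i
  proof -
    have "f i ` carrier G \<subseteq> carrier A" using f[OF that] by blast
    then show ?thesis by (rule A.free_Abelian_group_universal) blast
  qed
  then obtain k where k: "\<And>i. i \<in> I \<Longrightarrow> k i \<in> hom (free_Abelian_group (carrier G)) A"
      and kf: "\<And>i g. i \<in> I \<Longrightarrow> g \<in> carrier G \<Longrightarrow> k i (frag_of g) = f i g"
    by metis
  \<comment> \<open>\<open>gfinprod\<close> multiplies only the nontrivial factors, finitely many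
    for an element of the direct sum, so \<open>I\<close> may be infinite.\<close>
  let ?h = "\<lambda>x. gfinprod A (\<lambda>i. k i (x i)) I"
  have k0: "k i 0 = \<one>\<^bsub>A\<^esub>" if "i \<in> I" for i
    using hom_one[OF k[OF that]] by (simp add: A.group_axioms)
  have "?h \<in> hom (free_gmodule I G) A"
    unfolding free_gmodule_def by (rule A.hom_group_sum) (auto simp: k)
  moreover have "?h (free_basis I i g) = f i g" if i: "i \<in> I" and g: "g \<in> carrier G" for i g
  proof -
    have "?h (free_basis I i g) = gfinprod A (\<lambda>j. f i g) {i}"
      by (rule A.gfinprod_mono_neutral_cong_right)
        (use f i g kf k0 in \<open>auto simp: free_single_def\<close>)
    also have "\<dots> = f i g" using f[OF i g] by (simp add: A.finprod_singleton)
    finally show ?thesis .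
  qed
  ultimately show ?thesis by (rule that)
qed

section \<open>The free crossed module of a presentation\<close>

locale presentation =
  fixes X :: "'x set" and R :: "('x word \<times> 'x word) set"
    and G :: "('g, 'm) monoid_scheme" and \<theta> :: "'x word \<Rightarrow> 'g"
  assumes presentation: "is_presentation X R G \<theta>"
begin

abbreviation F :: "'x word monoid" where "F \<equiv> free_group X"

abbreviation N :: "'x word set" where "N \<equiv> kernel F G \<theta>"

abbreviation fmult :: "'x word \<Rightarrow> 'x word \<Rightarrow> 'x word" (infixl \<open>\<cdot>\<close> 70) where
  "u \<cdot> v \<equiv> u \<otimes>\<^bsub>F\<^esub> v"

abbreviation finv :: "'x word \<Rightarrow> 'x word" where "finv u \<equiv> inv\<^bsub>F\<^esub> u"

lemma R_words: "R \<subseteq> words X \<times> words X"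
  and group_G: "group G"
  and \<theta>_epi: "\<theta> \<in> epi F G"
  and kernel_eq: "N = normal_closure F (relators X R)"
  using presentation by (auto simp: is_presentation_def)

end

sublocale presentation \<subseteq> F: group F
  by (rule group_free_group)

sublocale presentation \<subseteq> G: group G
  by (rule group_G)

sublocale presentation \<subseteq> \<theta>: group_hom F G \<theta>
  using \<theta>_epi by unfold_locales (simp add: epi_def)

context presentation
begin

lemma one_F: "\<one>\<^bsub>F\<^esub> = []"
  by (simp add: free_group_def)

lemma \<theta>_surj: "\<theta> ` carrier F = carrier G"
  using \<theta>_epi by (simp add: epi_def)

lemma rho_closed:
  assumes "(l, r) \<in> R"
  shows "free_reduction l \<in> carrier F" "free_reduction r \<in> carrier F"
  using assms R_words by (auto intro: free_reduction_in_carrier)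

lemma relators_subset: "relators X R \<subseteq> N" "relators X R \<subseteq> carrier F"
proof -
  show "relators X R \<subseteq> N" unfolding kernel_eq normal_closure_def by blast
  then show "relators X R \<subseteq> carrier F" by (auto simp: kernel_def)
qed

lemma \<theta>_relation: "(l, r) \<in> R \<Longrightarrow> \<theta> (free_reduction l) = \<theta> (free_reduction r)"
proof -
  assume lr: "(l, r) \<in> R"
  then have "finv (free_reduction l) \<cdot> free_reduction r \<in> N"
    using relators_subset(1) by (auto simp: relators_def)
  then have "inv\<^bsub>G\<^esub> \<theta> (free_reduction l) \<otimes>\<^bsub>G\<^esub> \<theta> (free_reduction r) = \<one>\<^bsub>G\<^esub>"
    using rho_closed[OF lr] by (simp add: kernel_def)
  then show ?thesis
    using rho_closed[OF lr] by (metis G.inv_closed G.inv_equality G.inv_inv \<theta>.hom_closed)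
qed

text \<open>The label \<open>(q, (l, r))\<close> stands for the edges \<open>(p, l, r, q)\<close> with arbitrary \<open>p\<close>; the edge is
  determined by its label and its source.\<close>

definition labels :: "('x word \<times> 'x word \<times> 'x word) set" where
  "labels = carrier F \<times> R"

fun boundary :: "'x word \<times> 'x word \<times> 'x word \<Rightarrow> 'x word" where
  "boundary (q, l, r) = finv q \<cdot> (finv (free_reduction l) \<cdot> free_reduction r) \<cdot> q"

text \<open>The action of F(X) on the generators of the crossed module. It corresponds to whiskering
  on the right, which is all that a label sees of a conjugation.\<close>

fun translate :: "'x word \<Rightarrow> 'x word \<times> 'x word \<times> 'x word \<Rightarrow> 'x word \<times> 'x word \<times> 'x word" where
  "translate u (q, i) = (q \<cdot> u, i)"

lemma labels_cases:
  assumes "y \<in> labels"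
  obtains q l r where "y = (q, l, r)" "q \<in> carrier F" "(l, r) \<in> R"
    "free_reduction l \<in> carrier F" "free_reduction r \<in> carrier F"
  using assms rho_closed by (cases y) (auto simp: labels_def)

lemma boundary_closed [simp]: "y \<in> labels \<Longrightarrow> boundary y \<in> carrier F"
  by (elim labels_cases) simp

lemma \<theta>_boundary [simp]: "y \<in> labels \<Longrightarrow> \<theta> (boundary y) = \<one>\<^bsub>G\<^esub>"
  by (elim labels_cases) (simp add: \<theta>_relation)

lemma translate_closed [simp]: "y \<in> labels \<Longrightarrow> u \<in> carrier F \<Longrightarrow> translate u y \<in> labels"
  by (cases y) (simp add: labels_def)

lemma translate_translate:
  "y \<in> labels \<Longrightarrow> u \<in> carrier F \<Longrightarrow> v \<in> carrier F \<Longrightarrow>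
    translate v (translate u y) = translate (u \<cdot> v) y"
  by (cases y) (simp add: labels_def F.m_assoc)

lemma translate_one [simp]: "y \<in> labels \<Longrightarrow> translate \<one>\<^bsub>F\<^esub> y = y"
  by (cases y) (simp add: labels_def)

lemma boundary_translate:
  "y \<in> labels \<Longrightarrow> u \<in> carrier F \<Longrightarrow> boundary (translate u y) = finv u \<cdot> boundary y \<cdot> u"
  by (elim labels_cases) (simp add: F.m_assoc F.inv_mult_group)

text \<open>The 2-cells are the Peiffer relations \<open>y z = z y\<^sup>b\<close>, where \<open>b\<close> is the boundary of \<open>z\<close>.\<close>

definition peiffer_complex :: "(unit, 'x word \<times> 'x word \<times> 'x word) two_complex" where
  "peiffer_complex = \<lparr>verts = {()}, edges = labels, src = \<lambda>_. (), tgt = \<lambda>_. (),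
     cells = {([(y, True), (z, True)], [(z, True), (translate (boundary z) y, True)]) | y z.
       y \<in> labels \<and> z \<in> labels}\<rparr>"

text \<open>With a single vertex every word in the labels is a loop, so the group with these
  generators and relations is literally a fundamental group, and path values define homomorphisms
  out of it.\<close>

abbreviation crossed_module ::
  "('x word \<times> 'x word \<times> 'x word) path set monoid" ("C") where
  "C \<equiv> fundamental_group peiffer_complex ()"

abbreviation label_words :: "('x word \<times> 'x word \<times> 'x word) path set" where
  "label_words \<equiv> loops peiffer_complex ()"

abbreviation cls :: "('x word \<times> 'x word \<times> 'x word) path \<Rightarrow>
    ('x word \<times> 'x word \<times> 'x word) path set" where
  "cls \<equiv> loop_class peiffer_complex ()"

end

sublocale presentation \<subseteq> C: group C
  by (rule group_fundamental_group) (simp add: peiffer_complex_def)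

sublocale presentation \<subseteq> M: comm_group "free_gmodule R G"
  by (rule comm_group_free_gmodule)

context presentation
begin

lemma is_path_peiffer: "is_path peiffer_complex v w v' \<longleftrightarrow> fst ` set w \<subseteq> labels"
  by (induction w) (auto simp: peiffer_complex_def)

lemma label_words_iff: "w \<in> label_words \<longleftrightarrow> fst ` set w \<subseteq> labels"
  by (simp add: loops_def is_path_peiffer)

lemma edges_peiffer [simp]: "edges peiffer_complex = labels"
  by (simp add: peiffer_complex_def)

lemma cells_peifferE:
  assumes "(c, d) \<in> cells peiffer_complex"
  obtains y z where "y \<in> labels" "z \<in> labels" "c = [(y, True), (z, True)]"
    "d = [(z, True), (translate (boundary z) y, True)]"
  using assms by (auto simp: peiffer_complex_def)

abbreviation word_boundary :: "('x word \<times> 'x word \<times> 'x word) path \<Rightarrow> 'x word" where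
  "word_boundary \<equiv> F.path_value boundary"

abbreviation bd :: "('x word \<times> 'x word \<times> 'x word) path set \<Rightarrow> 'x word" where
  "bd \<equiv> F.class_value boundary"

fun label_basis :: "'x word \<times> 'x word \<times> 'x word \<Rightarrow> 'x word \<times> 'x word \<Rightarrow> ('g \<Rightarrow>\<^sub>0 int)" where
  "label_basis (q, i) = free_basis R i (\<theta> q)"

abbreviation word_count :: "('x word \<times> 'x word \<times> 'x word) path \<Rightarrow>
    'x word \<times> 'x word \<Rightarrow> ('g \<Rightarrow>\<^sub>0 int)" where
  "word_count \<equiv> M.path_value label_basis"

abbreviation count :: "('x word \<times> 'x word \<times> 'x word) path set \<Rightarrow>
    'x word \<times> 'x word \<Rightarrow> ('g \<Rightarrow>\<^sub>0 int)" where
  "count \<equiv> M.class_value label_basis"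

lemma label_basis_closed [simp]: "y \<in> labels \<Longrightarrow> label_basis y \<in> carrier (free_gmodule R G)"
  by (cases y) (auto simp: labels_def intro!: free_single_closed)

lemma word_boundary_closed [simp]: "w \<in> label_words \<Longrightarrow> word_boundary w \<in> carrier F"
  by (simp add: label_words_iff F.path_value_closed[of _ labels])

lemma word_boundary_cells:
  "(c, d) \<in> cells peiffer_complex \<Longrightarrow> word_boundary c = word_boundary d"
proof (erule cells_peifferE)
  fix y z assume "y \<in> labels" "z \<in> labels" "c = [(y, True), (z, True)]"
    "d = [(z, True), (translate (boundary z) y, True)]"
  moreover from this have "boundary z \<cdot> (finv (boundary z) \<cdot> boundary y \<cdot> boundary z) = boundary y \<cdot> boundary z"
    by (simp add: F.m_assoc[symmetric])
  ultimately show ?thesis by (simp add: boundary_translate)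
qed

lemma label_basis_translate:
  assumes "y \<in> labels" "u \<in> carrier F" "\<theta> u = \<one>\<^bsub>G\<^esub>"
  shows "label_basis (translate u y) = label_basis y"
  using assms by (elim labels_cases) simp

text \<open>The boundary of \<open>z\<close> lies in \<open>N\<close>, and the basis element of a
  label depends on its word only modulo \<open>N\<close>. So the translation in the Peiffer relation
  is invisible and only commutativity is left.\<close>

lemma word_count_cells:
  assumes "(c, d) \<in> cells peiffer_complex" shows "word_count c = word_count d"
  using assms
proof (rule cells_peifferE)
  fix y z assume yz: "y \<in> labels" "z \<in> labels" and cd: "c = [(y, True), (z, True)]"
    "d = [(z, True), (translate (boundary z) y, True)]"
  show ?thesis
    unfolding cd M.path_value.simps M.signed.simps if_True
    using yz M.m_comm[of "label_basis y" "label_basis z"]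
    by (simp add: label_basis_translate)
qed

lemma boundary_funcset: "boundary \<in> edges peiffer_complex \<rightarrow> carrier F"
  by simp

lemma label_basis_funcset: "label_basis \<in> edges peiffer_complex \<rightarrow> carrier (free_gmodule R G)"
  by simp

lemma bd_cls: "w \<in> label_words \<Longrightarrow> bd (cls w) = word_boundary w"
  by (rule F.class_value_loop_class[OF boundary_funcset word_boundary_cells])

lemma count_cls: "w \<in> label_words \<Longrightarrow> count (cls w) = word_count w"
  by (rule M.class_value_loop_class[OF label_basis_funcset word_count_cells])

end

sublocale presentation \<subseteq> bd: group_hom C F bd
  by unfold_locales (rule F.class_value_hom[OF boundary_funcset word_boundary_cells])

sublocale presentation \<subseteq> count: group_hom C "free_gmodule R G" count
  by unfold_locales (rule M.class_value_hom[OF label_basis_funcset word_count_cells])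

context presentation
begin

abbreviation gen :: "'x word \<times> 'x word \<times> 'x word \<Rightarrow> ('x word \<times> 'x word \<times> 'x word) path set" where
  "gen y \<equiv> cls [(y, True)]"

lemma Nil_label_words [simp]: "[] \<in> label_words"
  by (simp add: label_words_iff)

lemma Cons_label_words [simp]:
  "(y, s) # w \<in> label_words \<longleftrightarrow> y \<in> labels \<and> w \<in> label_words"
  by (simp add: label_words_iff)

lemma cls_closed [simp]: "w \<in> label_words \<Longrightarrow> cls w \<in> carrier C"
  by (simp add: fundamental_group_carrier)

lemma crossed_module_cases:
  assumes "c \<in> carrier C" obtains w where "w \<in> label_words" "c = cls w"
  using assms by (auto simp: fundamental_group_carrier)

lemma cls_Nil: "cls [] = \<one>\<^bsub>C\<^esub>"
  by (simp add: fundamental_group_one)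

lemma cls_Cons:
  assumes "y \<in> labels" "w \<in> label_words"
  shows "cls ((y, s) # w) = C.signed (gen y) s \<otimes>\<^bsub>C\<^esub> cls w"
proof -
  have "cls [(y, False)] \<otimes>\<^bsub>C\<^esub> gen y = \<one>\<^bsub>C\<^esub>"
  proof -
    have "homotopy_step peiffer_complex ([] @ [(y, False), (y, \<not> False)] @ []) ([] @ [])"
      by (rule homotopy_step.backtrack)
    then have "([(y, False), (y, True)], []) \<in> loop_homotopy peiffer_complex ()"
      using assms by (auto simp: loop_homotopy_def)
    then show ?thesis
      using assms by (simp add: fundamental_group_mult fundamental_group_one loop_class_eq_iff)
  qed
  then have "C.signed (gen y) s = cls [(y, s)]"
    using assms C.inv_equality[of "cls [(y, False)]" "gen y"] by (cases s) simp_all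
  then show ?thesis using assms by (simp add: fundamental_group_mult)
qed

lemma path_value_gen: "w \<in> label_words \<Longrightarrow> C.path_value gen w = cls w"
proof (induction w)
  case (Cons x w)
  obtain y s where "x = (y, s)" by (cases x)
  then show ?case using Cons cls_Cons[of y w s] by simp
qed (simp add: cls_Nil)

lemma peiffer_relation:
  assumes "y \<in> labels" "z \<in> labels"
  shows "gen y \<otimes>\<^bsub>C\<^esub> gen z = gen z \<otimes>\<^bsub>C\<^esub> gen (translate (boundary z) y)"
proof -
  have "([(y, True), (z, True)], [(z, True), (translate (boundary z) y, True)]) \<in> cells peiffer_complex"
    unfolding peiffer_complex_def two_complex.simps mem_Collect_eq
    by (rule exI[of _ y], rule exI[of _ z]) (simp only: assms simp_thms)
  from homotopy_step.cell[OF this, of "[]" "[]"]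
  have "([(y, True), (z, True)], [(z, True), (translate (boundary z) y, True)])
      \<in> loop_homotopy peiffer_complex ()"
    using assms by (auto simp: loop_homotopy_def)
  then show ?thesis using assms by (simp add: fundamental_group_mult loop_class_eq_iff)
qed

text \<open>The Peiffer identity of a crossed module, extended from pairs of generators to a
  generator and an arbitrary word: conjugating by a class acts through its boundary.\<close>

lemma gen_swap:
  assumes "w \<in> label_words" "y \<in> labels"
  shows "gen y \<otimes>\<^bsub>C\<^esub> cls w = cls w \<otimes>\<^bsub>C\<^esub> gen (translate (word_boundary w) y)"
  using assms
proof (induction w arbitrary: y)
  case Nil
  then show ?case by (simp add: cls_Nil)
next
  case (Cons x w)
  obtain z s where x: "x = (z, s)" by (cases x)
  have z: "z \<in> labels" and w: "w \<in> label_words" and y: "y \<in> labels" using Cons.prems x by auto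
  let ?b = "F.signed (boundary z) s"
  have b: "?b \<in> carrier F" using z by simp
  have "gen y \<otimes>\<^bsub>C\<^esub> C.signed (gen z) s = C.signed (gen z) s \<otimes>\<^bsub>C\<^esub> gen (translate ?b y)"
  proof (cases s)
    case True
    then show ?thesis using peiffer_relation[OF y z] by simp
  next
    case False
    \<comment> \<open>For an inverse letter the relation is applied to \<open>y\<close> translated
      back, so that translating by the boundary of \<open>z\<close> returns \<open>y\<close>; then
      \<open>gen z\<close> is moved to the other sides.\<close>
    let ?y = "translate (finv (boundary z)) y"
    have yc: "?y \<in> labels" using y z by simp
    then have "gen ?y \<otimes>\<^bsub>C\<^esub> gen z = gen z \<otimes>\<^bsub>C\<^esub> gen y"
      using peiffer_relation[of ?y z] y z by (simp add: translate_translate)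
    then have "gen y = inv\<^bsub>C\<^esub> gen z \<otimes>\<^bsub>C\<^esub> (gen ?y \<otimes>\<^bsub>C\<^esub> gen z)"
      using y z by (simp add: C.inv_solve_left)
    then have "gen y \<otimes>\<^bsub>C\<^esub> inv\<^bsub>C\<^esub> gen z = inv\<^bsub>C\<^esub> gen z \<otimes>\<^bsub>C\<^esub> gen ?y"
      using y z yc by (simp add: C.m_assoc)
    then show ?thesis using False by simp
  qed
  moreover have "gen (translate ?b y) \<in> carrier C" "C.signed (gen z) s \<in> carrier C"
    using y z translate_closed[OF y b] by (simp_all del: F.signed.simps)
  ultimately have "gen y \<otimes>\<^bsub>C\<^esub> cls (x # w) = C.signed (gen z) s \<otimes>\<^bsub>C\<^esub> (gen (translate ?b y) \<otimes>\<^bsub>C\<^esub> cls w)"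
    unfolding x cls_Cons[OF z w] using y w
    by (simp add: C.m_assoc[symmetric] del: C.signed.simps F.signed.simps)
  also have "\<dots> = C.signed (gen z) s \<otimes>\<^bsub>C\<^esub> (cls w \<otimes>\<^bsub>C\<^esub> gen (translate (word_boundary w) (translate ?b y)))"
    using Cons.IH[OF w translate_closed[OF y b]] by (simp only:)
  also have "\<dots> = cls (x # w) \<otimes>\<^bsub>C\<^esub> gen (translate (word_boundary (x # w)) y)"
  proof -
    have xw: "x # w \<in> label_words" using x z w by simp
    have "translate (word_boundary w) (translate ?b y) = translate (word_boundary (x # w)) y"
      using translate_translate[OF y b word_boundary_closed[OF w]]
      by (simp only: x F.path_value.simps)
    moreover have "gen (translate (word_boundary (x # w)) y) \<in> carrier C"
      using translate_closed[OF y word_boundary_closed[OF xw]] by (simp del: F.path_value.simps)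
    ultimately show ?thesis
      unfolding x cls_Cons[OF z w] using z w by (simp only: C.m_assoc C.signed_closed cls_closed Cons_label_words Nil_label_words)
  qed
  finally show ?case .
qed

lemma normal_N: "N \<lhd> F"
  by (rule \<theta>.normal_kernel)

lemma N_closed: "n \<in> N \<Longrightarrow> n \<in> carrier F"
  by (simp add: kernel_def)

section \<open>Action of the free group on words; image and kernel of the boundary\<close>

definition translate_word ::
  "'x word \<Rightarrow> ('x word \<times> 'x word \<times> 'x word) path \<Rightarrow> ('x word \<times> 'x word \<times> 'x word) path" where
  "translate_word u = map (\<lambda>(y, s). (translate u y, s))"

lemma translate_word_closed:
  "w \<in> label_words \<Longrightarrow> u \<in> carrier F \<Longrightarrow> translate_word u w \<in> label_words"
  by (induction w) (auto simp: translate_word_def simp del: translate.simps)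

text \<open>The other axiom of a crossed module, equivariance of the boundary. Conjugation by
  \<open>u\<close> is an endomorphism of F(X), so it is enough to compare single labels.\<close>

lemma word_boundary_translate:
  assumes w: "w \<in> label_words" and u: "u \<in> carrier F"
  shows "word_boundary (translate_word u w) = finv u \<cdot> word_boundary w \<cdot> u"
proof -
  have hom: "(\<lambda>x. finv u \<cdot> x \<cdot> u) \<in> hom F F"
  proof (rule homI)
    fix x y assume xy: "x \<in> carrier F" "y \<in> carrier F"
    have "u \<cdot> (finv u \<cdot> (y \<cdot> u)) = y \<cdot> u"
      using xy u by (simp add: F.m_assoc[symmetric])
    then show "finv u \<cdot> (x \<cdot> y) \<cdot> u = finv u \<cdot> x \<cdot> u \<cdot> (finv u \<cdot> y \<cdot> u)"
      using xy u by (simp add: F.m_assoc)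
  qed (use u in simp)
  have w': "fst ` set w \<subseteq> labels" using w by (simp add: label_words_iff)
  have "finv u \<cdot> word_boundary w \<cdot> u = F.path_value (\<lambda>y. finv u \<cdot> boundary y \<cdot> u) w"
    by (rule F.path_value_hom[OF F.group_axioms hom w']) simp
  also have "\<dots> = F.path_value (\<lambda>y. boundary (translate u y)) w"
    by (rule F.path_value_cong[OF w']) (rule boundary_translate[OF _ u, symmetric])
  finally show ?thesis by (simp add: translate_word_def F.path_value_map)
qed

text \<open>Acting by \<open>\<theta> u\<close> is an endomorphism of the free module, so again
  single labels suffice. Equivariance of both maps of the exact sequence rests on this.\<close>

lemma word_count_translate:
  assumes w: "w \<in> label_words" and u: "u \<in> carrier F"
  shows "word_count (translate_word u w) = free_gmodule_act R G (word_count w) (\<theta> u)"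
proof -
  interpret act: right_gmodule G "free_gmodule R G" "free_gmodule_act R G"
    by (rule right_gmodule_free_gmodule[OF group_G])
  have w': "fst ` set w \<subseteq> labels" using w by (simp add: label_words_iff)
  have "free_gmodule_act R G (word_count w) (\<theta> u) =
      M.path_value (\<lambda>y. free_gmodule_act R G (label_basis y) (\<theta> u)) w"
    using M.path_value_hom[OF M.group_axioms act.act_hom[OF \<theta>.hom_closed[OF u]] w']
      label_basis_funcset by simp
  also have "\<dots> = M.path_value (\<lambda>y. label_basis (translate u y)) w"
  proof (rule M.path_value_cong[OF w'])
    fix y assume "y \<in> labels"
    then show "free_gmodule_act R G (label_basis y) (\<theta> u) = label_basis (translate u y)"
      using u by (elim labels_cases) (simp add: free_gmodule_act_basis)
  qed
  finally show ?thesis by (simp add: translate_word_def M.path_value_map)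
qed

lemma word_boundary_in_N:
  assumes "w \<in> label_words" shows "word_boundary w \<in> N"
proof -
  have w': "fst ` set w \<subseteq> labels" using assms by (simp add: label_words_iff)
  have "\<theta> (word_boundary w) = G.path_value (\<lambda>y. \<theta> (boundary y)) w"
    using F.path_value_hom[OF group_G \<theta>.homh w'] boundary_funcset by simp
  also have "\<dots> = G.path_value (\<lambda>_. \<one>\<^bsub>G\<^esub>) w"
    by (rule G.path_value_cong[OF w']) (rule \<theta>_boundary)
  also have "\<dots> = \<one>\<^bsub>G\<^esub>" by (induction w) auto
  finally show ?thesis using assms by (simp add: kernel_def)
qed

text \<open>\<open>N\<close> is the least normal subgroup containing the relators. The image
  contains them as boundaries of labels with \<open>q\<close> = 1, and it is normal because
  translating a word conjugates its boundary.\<close>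

lemma bd_image: "bd ` carrier C = N"
proof
  show "bd ` carrier C \<subseteq> N"
  proof safe
    fix c assume "c \<in> carrier C"
    then obtain w where "w \<in> label_words" "c = cls w" by (rule crossed_module_cases)
    then show "bd c \<in> N" using word_boundary_in_N by (simp add: bd_cls)
  qed
  have "bd ` carrier C \<lhd> F"
    unfolding F.normal_inv_iff
  proof (intro conjI ballI)
    show "subgroup (bd ` carrier C) F" by (rule bd.img_is_subgroup)
    fix x n assume x: "x \<in> carrier F" and "n \<in> bd ` carrier C"
    then obtain c where "c \<in> carrier C" and n: "n = bd c" by blast
    then obtain w where w: "w \<in> label_words" "c = cls w" by (auto elim: crossed_module_cases)
    then have "x \<cdot> n \<cdot> finv x = bd (cls (translate_word (finv x) w))"
      using x n word_boundary_translate[of w "finv x"] translate_word_closed[of w "finv x"]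
      by (simp add: bd_cls)
    then show "x \<cdot> n \<cdot> finv x \<in> bd ` carrier C"
      using cls_closed[OF translate_word_closed[OF w(1), of "finv x"]] x by auto
  qed
  moreover have "relators X R \<subseteq> bd ` carrier C"
  proof
    fix n assume "n \<in> relators X R"
    then obtain l r where lr: "(l, r) \<in> R" and n: "n = finv (free_reduction l) \<cdot> free_reduction r"
      by (auto simp: relators_def)
    let ?w = "[((\<one>\<^bsub>F\<^esub>, l, r), True)]"
    have w: "?w \<in> label_words" using lr by (simp add: labels_def)
    then have "bd (cls ?w) = n" using rho_closed[OF lr] by (simp add: bd_cls n)
    then show "n \<in> bd ` carrier C" using cls_closed[OF w] by blast
  qed
  ultimately show "N \<subseteq> bd ` carrier C"
    unfolding kernel_eq normal_closure_def by blast
qed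

abbreviation K :: "('x word \<times> 'x word \<times> 'x word) path set set" where
  "K \<equiv> kernel C F bd"

text \<open>For an element of trivial boundary the translation in \<open>gen_swap\<close> is the
  identity, so it commutes with every generator, hence with the inverses and with every
  word.\<close>

lemma K_central:
  assumes k: "k \<in> K" and c: "c \<in> carrier C"
  shows "k \<otimes>\<^bsub>C\<^esub> c = c \<otimes>\<^bsub>C\<^esub> k"
proof -
  have kC: "k \<in> carrier C" and bk: "bd k = \<one>\<^bsub>F\<^esub>" using k by (auto simp: kernel_def)
  obtain v where v: "v \<in> label_words" "k = cls v" using kC by (rule crossed_module_cases)
  have gen: "gen y \<otimes>\<^bsub>C\<^esub> k = k \<otimes>\<^bsub>C\<^esub> gen y" if "y \<in> labels" for y
    using gen_swap[OF v(1) that] bk that unfolding v(2) bd_cls[OF v(1)] by simp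
  have sgen: "k \<otimes>\<^bsub>C\<^esub> C.signed (gen y) s = C.signed (gen y) s \<otimes>\<^bsub>C\<^esub> k" if y: "y \<in> labels" for y s
  proof -
    have g: "gen y \<in> carrier C" using y by simp
    have "gen y \<otimes>\<^bsub>C\<^esub> (k \<otimes>\<^bsub>C\<^esub> inv\<^bsub>C\<^esub> gen y) = k"
      using g kC gen[OF y] by (simp add: C.m_assoc[symmetric]) (simp add: C.m_assoc)
    then have "k \<otimes>\<^bsub>C\<^esub> inv\<^bsub>C\<^esub> gen y = inv\<^bsub>C\<^esub> gen y \<otimes>\<^bsub>C\<^esub> k"
      using g kC by (metis C.inv_solve_left C.inv_closed C.m_closed)
    then show ?thesis using gen[OF y] by simp
  qed
  have "k \<otimes>\<^bsub>C\<^esub> cls w = cls w \<otimes>\<^bsub>C\<^esub> k" if "w \<in> label_words" for w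
    using that
  proof (induction w)
    case Nil
    then show ?case using kC by (simp add: cls_Nil)
  next
    case (Cons x w)
    obtain y s where x: "x = (y, s)" by (cases x)
    let ?g = "C.signed (gen y) s"
    have y: "y \<in> labels" and w: "w \<in> label_words" using Cons.prems x by auto
    have g: "?g \<in> carrier C" using y by (intro C.signed_closed) simp
    have "k \<otimes>\<^bsub>C\<^esub> (?g \<otimes>\<^bsub>C\<^esub> cls w) = ?g \<otimes>\<^bsub>C\<^esub> k \<otimes>\<^bsub>C\<^esub> cls w"
      using g w kC sgen[OF y, of s] by (simp add: C.m_assoc[symmetric] del: C.signed.simps)
    also have "\<dots> = ?g \<otimes>\<^bsub>C\<^esub> cls w \<otimes>\<^bsub>C\<^esub> k"
      using g w kC Cons.IH[OF w] by (simp add: C.m_assoc del: C.signed.simps)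
    finally show ?case unfolding x cls_Cons[OF y w] .
  qed
  then show ?thesis using c by (auto elim: crossed_module_cases)
qed

lemma subgroup_K: "subgroup K C"
  by (rule bd.subgroup_kernel)

lemma comm_group_K: "comm_group (C\<lparr>carrier := K\<rparr>)"
proof (rule group.group_comm_groupI)
  show "group (C\<lparr>carrier := K\<rparr>)" by (rule C.subgroup_imp_group[OF subgroup_K])
  fix x y assume "x \<in> carrier (C\<lparr>carrier := K\<rparr>)" "y \<in> carrier (C\<lparr>carrier := K\<rparr>)"
  then show "x \<otimes>\<^bsub>C\<lparr>carrier := K\<rparr>\<^esub> y = y \<otimes>\<^bsub>C\<lparr>carrier := K\<rparr>\<^esub> x"
    using K_central[of x y] by (simp add: kernel_def)
qed

end

section \<open>Splitting the crossed module over the kernel\<close>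

context presentation
begin

text \<open>The representative of 1 is fixed to be 1. With another choice \<open>t\<close> the
  boundary of \<open>section_map n\<close> would be the conjugate \<open>t n t^-1\<close> instead of
  \<open>n\<close>.\<close>

definition transversal :: "'g \<Rightarrow> 'x word" where
  "transversal g =
    (if g = \<one>\<^bsub>G\<^esub> then \<one>\<^bsub>F\<^esub> else (SOME u. u \<in> carrier F \<and> \<theta> u = g))"

lemma transversal:
  assumes "g \<in> carrier G"
  shows transversal_closed: "transversal g \<in> carrier F" and \<theta>_transversal: "\<theta> (transversal g) = g"
proof -
  have "\<exists>u. u \<in> carrier F \<and> \<theta> u = g" using assms \<theta>_surj by (metis imageE)
  from someI_ex[OF this] have "transversal g \<in> carrier F \<and> \<theta> (transversal g) = g"
    unfolding transversal_def by (cases "g = \<one>\<^bsub>G\<^esub>") (simp, simp only: if_False)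
  then show "transversal g \<in> carrier F" "\<theta> (transversal g) = g" by simp_all
qed

abbreviation letters :: "'x letter set" where "letters \<equiv> X \<times> UNIV"

lemma letter_closed: "a \<in> letters \<Longrightarrow> [a] \<in> carrier F"
  by (auto simp: free_group_def words_def)

lemma inv_letter_letters: "a \<in> letters \<Longrightarrow> inv_letter a \<in> letters"
  by (cases a) auto

lemma letter_mult_inv: "[a] \<cdot> [inv_letter a] = \<one>\<^bsub>F\<^esub>"
  by (simp add: free_group_mult_eq one_F)

lemma Cons_words: "a # w \<in> words X \<longleftrightarrow> a \<in> letters \<and> w \<in> words X"
  by (cases a) (auto simp: words_def)

lemma free_reduction_Nil: "free_reduction [] = \<one>\<^bsub>F\<^esub>"
  by (simp add: free_reduction_def one_F)

lemma free_reduction_Cons: "free_reduction (a # w) = [a] \<cdot> free_reduction w"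
  using free_reduction_append[of "[a]" w X] by (simp add: free_reduction_def)

text \<open>The elements of \<open>G\<close> serve as the right cosets of \<open>N\<close>; this is
  the edge labelled \<open>a\<close> of the Cayley graph.\<close>

definition next_state :: "'g \<Rightarrow> 'x letter \<Rightarrow> 'g" where
  "next_state g a = g \<otimes>\<^bsub>G\<^esub> \<theta> [a]"

lemma next_state_closed: "g \<in> carrier G \<Longrightarrow> a \<in> letters \<Longrightarrow> next_state g a \<in> carrier G"
  by (simp add: next_state_def letter_closed)

lemma next_state_inv:
  assumes "g \<in> carrier G" "a \<in> letters"
  shows "next_state (next_state g a) (inv_letter a) = g"
proof -
  have c: "[a] \<in> carrier F" "[inv_letter a] \<in> carrier F"
    using assms inv_letter_letters letter_closed by metis+
  have "\<theta> [a] \<otimes>\<^bsub>G\<^esub> \<theta> [inv_letter a] = \<one>\<^bsub>G\<^esub>"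
    using \<theta>.hom_mult[OF c] by (simp add: letter_mult_inv)
  then show ?thesis using assms c by (simp add: next_state_def G.m_assoc)
qed

lemma bd_lift:
  assumes "n \<in> N" shows "\<exists>c. c \<in> carrier C \<and> bd c = n"
proof -
  from assms have "n \<in> bd ` carrier C" by (simp only: bd_image)
  then show ?thesis by (elim imageE) (rule exI, rule conjI, assumption, rule sym)
qed

text \<open>The splitting is the restriction of a lift of \<open>F(X)\<close> to a wreath product of the crossed
  module with the symmetric group of \<open>G = F(X)/N\<close>: the free group acts on states \<open>g \<in> G\<close>, and each
  letter read in state \<open>g\<close> contributes a lift of the corresponding Schreier element of \<open>N\<close>. This
  makes the freeness of \<open>N\<close> unnecessary.\<close>

definition schreier :: "'g \<Rightarrow> 'x letter \<Rightarrow> 'x word" where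
  "schreier g a = transversal g \<cdot> [a] \<cdot> finv (transversal (next_state g a))"

lemma schreier_in_N:
  assumes "g \<in> carrier G" "a \<in> letters" shows "schreier g a \<in> N"
proof -
  note c = next_state_closed[OF assms] letter_closed[OF assms(2)]
  have "\<theta> (schreier g a) = g \<otimes>\<^bsub>G\<^esub> \<theta> [a] \<otimes>\<^bsub>G\<^esub> inv\<^bsub>G\<^esub> (next_state g a)"
    using assms(1) c by (simp add: schreier_def transversal)
  also have "\<dots> = \<one>\<^bsub>G\<^esub>" using G.r_inv[OF c(1)] by (simp add: next_state_def)
  finally have "\<theta> (schreier g a) = \<one>\<^bsub>G\<^esub>" .
  moreover have "schreier g a \<in> carrier F"
    unfolding schreier_def by (intro F.m_closed F.inv_closed transversal_closed assms c)
  ultimately show ?thesis unfolding kernel_def by (intro CollectI conjI)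
qed

definition lift_gen where
  "lift_gen g a = (SOME c. c \<in> carrier C \<and> bd c = schreier g a)"

lemma lift_gen:
  assumes "g \<in> carrier G" "a \<in> letters"
  shows "lift_gen g a \<in> carrier C" "bd (lift_gen g a) = schreier g a"
proof -
  from someI_ex[OF bd_lift[OF schreier_in_N[OF assms]]] have "lift_gen g a \<in> carrier C \<and> bd (lift_gen g a) = schreier g a"
    unfolding lift_gen_def .
  then show "lift_gen g a \<in> carrier C" "bd (lift_gen g a) = schreier g a" by simp_all
qed

text \<open>Lifts are chosen for positive letters only. A negative letter takes the inverse of the
  lift of its positive partner, read from the state that it leads to, so that a letter followed by
  its inverse contributes 1.\<close>

definition lift_letter where
  "lift_letter g a =
    (if snd a then lift_gen g a else inv\<^bsub>C\<^esub> lift_gen (next_state g a) (inv_letter a))"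

lemma lift_letter_closed:
  assumes "g \<in> carrier G" "a \<in> letters" shows "lift_letter g a \<in> carrier C"
  using lift_gen(1)[OF assms]
    lift_gen(1)[OF next_state_closed[OF assms] inv_letter_letters[OF assms(2)]]
  by (simp add: lift_letter_def)

lemma lift_letter_inv:
  assumes "g \<in> carrier G" "a \<in> letters"
  shows "lift_letter g a \<otimes>\<^bsub>C\<^esub> lift_letter (next_state g a) (inv_letter a) = \<one>\<^bsub>C\<^esub>"
proof -
  have s: "snd (inv_letter a) = (\<not> snd a)" by (cases a) simp
  show ?thesis
    using assms lift_gen(1)[OF assms]
      lift_gen(1)[OF next_state_closed[OF assms] inv_letter_letters[OF assms(2)]]
    by (simp add: lift_letter_def s next_state_inv)
qed

text \<open>Schreier elements have the same symmetry as the one built into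
  \<open>lift_letter\<close>, so the values forced at negative letters are lifts as well.\<close>

lemma schreier_inv:
  assumes "g \<in> carrier G" "a \<in> letters"
  shows "finv (schreier (next_state g a) (inv_letter a)) = schreier g a"
proof -
  have c: "[a] \<in> carrier F" "[inv_letter a] \<in> carrier F"
    using assms inv_letter_letters letter_closed by metis+
  then have "finv [inv_letter a] = [a]" by (simp add: F.inv_equality letter_mult_inv)
  then show ?thesis
    using assms c next_state_closed[OF assms]
    by (simp add: schreier_def next_state_inv transversal F.inv_mult_group F.m_assoc)
qed

lemma bd_lift_letter:
  assumes "g \<in> carrier G" "a \<in> letters" shows "bd (lift_letter g a) = schreier g a"
proof (cases "snd a")
  case False
  have "lift_gen (next_state g a) (inv_letter a) \<in> carrier C"
      "bd (lift_gen (next_state g a) (inv_letter a)) = schreier (next_state g a) (inv_letter a)"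
    using lift_gen[OF next_state_closed[OF assms] inv_letter_letters[OF assms(2)]] .
  then show ?thesis using False by (simp add: lift_letter_def schreier_inv[OF assms])
qed (simp add: lift_letter_def lift_gen[OF assms])

text \<open>The component at state \<open>g\<close> of the image of the word in the wreath product:
  the word is run from \<open>g\<close>, collecting the contribution of each letter in the state in
  which it is read.\<close>

primrec lift_word where
  "lift_word [] g = \<one>\<^bsub>C\<^esub>"
| "lift_word (a # w) g = lift_letter g a \<otimes>\<^bsub>C\<^esub> lift_word w (next_state g a)"

lemma lift_word_closed:
  "w \<in> words X \<Longrightarrow> g \<in> carrier G \<Longrightarrow> lift_word w g \<in> carrier C"
  by (induction w arbitrary: g) (auto simp: Cons_words lift_letter_closed next_state_closed)

text \<open>A cancelling pair contributes 1 and returns to the state before it. Hence the value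
  depends only on the element of F(X) that the word represents.\<close>

lemma lift_word_cancel_cons:
  assumes "a \<in> letters" "w \<in> words X" "g \<in> carrier G"
  shows "lift_word (cancel_cons a w) g = lift_word (a # w) g"
proof (cases w)
  case (Cons b v)
  show ?thesis
  proof (cases "b = inv_letter a")
    case True
    have v: "v \<in> words X" using assms(2) Cons by (simp add: Cons_words)
    have "lift_word (a # w) g = lift_letter g a \<otimes>\<^bsub>C\<^esub>
        (lift_letter (next_state g a) (inv_letter a) \<otimes>\<^bsub>C\<^esub> lift_word v g)"
      using assms by (simp add: Cons True next_state_inv)
    also have "\<dots> = lift_letter g a \<otimes>\<^bsub>C\<^esub> lift_letter (next_state g a) (inv_letter a) \<otimes>\<^bsub>C\<^esub> lift_word v g"
      by (intro C.m_assoc[symmetric] lift_letter_closed next_state_closed inv_letter_letters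
          lift_word_closed assms v)
    also have "\<dots> = lift_word v g"
      using lift_word_closed[OF v assms(3)] by (simp add: lift_letter_inv[OF assms(3,1)])
    finally show ?thesis by (simp add: Cons True)
  qed (simp add: Cons)
qed simp

lemma lift_word_foldr:
  assumes "u \<in> words X" "v \<in> words X" "g \<in> carrier G"
  shows "lift_word (foldr cancel_cons u v) g = lift_word (u @ v) g"
  using assms(1,3)
proof (induction u arbitrary: g)
  case (Cons a u)
  then have a: "a \<in> letters" and u: "u \<in> words X" by (auto simp: Cons_words)
  then show ?case
    using lift_word_cancel_cons[OF a foldr_words[OF u assms(2)] Cons.prems(2)]
      Cons.IH[OF u next_state_closed[OF Cons.prems(2) a]] by simp
qed simp

text \<open>A cocycle identity. If \<open>u\<close> represents an element of \<open>N\<close>, the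
  state is unchanged after \<open>u\<close>, so at a fixed state this is multiplicativity on
  \<open>N\<close>.\<close>

lemma lift_word_append:
  assumes "u \<in> words X" "v \<in> words X" "g \<in> carrier G"
  shows "lift_word (u @ v) g =
    lift_word u g \<otimes>\<^bsub>C\<^esub> lift_word v (g \<otimes>\<^bsub>G\<^esub> \<theta> (free_reduction u))"
  using assms(1,3)
proof (induction u arbitrary: g)
  case Nil
  then show ?case
    using assms(2) by (simp add: free_reduction_Nil lift_word_closed)
next
  case (Cons a u)
  have a: "a \<in> letters" and u: "u \<in> words X" using Cons.prems by (auto simp: Cons_words)
  note c = letter_closed[OF a] free_reduction_in_carrier[OF u]
  have g: "g \<otimes>\<^bsub>G\<^esub> \<theta> (free_reduction (a # u)) = next_state g a \<otimes>\<^bsub>G\<^esub> \<theta> (free_reduction u)"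
    using c Cons.prems(2) by (simp add: free_reduction_Cons next_state_def G.m_assoc)
  have n: "next_state g a \<in> carrier G" by (rule next_state_closed[OF Cons.prems(2) a])
  have "lift_word (a # u @ v) g = lift_letter g a \<otimes>\<^bsub>C\<^esub>
      (lift_word u (next_state g a) \<otimes>\<^bsub>C\<^esub> lift_word v (next_state g a \<otimes>\<^bsub>G\<^esub> \<theta> (free_reduction u)))"
    using Cons.IH[OF u n] by simp
  also have "\<dots> = lift_letter g a \<otimes>\<^bsub>C\<^esub> lift_word u (next_state g a) \<otimes>\<^bsub>C\<^esub>
      lift_word v (next_state g a \<otimes>\<^bsub>G\<^esub> \<theta> (free_reduction u))"
    using n c u assms(2) Cons.prems(2) a
    by (intro C.m_assoc[symmetric] lift_letter_closed lift_word_closed) simp_all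
  finally show ?case by (simp add: g)
qed

text \<open>The product of Schreier elements telescopes: only the representatives of the first and
  last state survive. From state 1 and for a word in \<open>N\<close> both are 1.\<close>

lemma bd_lift_word:
  assumes "w \<in> words X" "g \<in> carrier G"
  shows "bd (lift_word w g) =
    transversal g \<cdot> free_reduction w \<cdot> finv (transversal (g \<otimes>\<^bsub>G\<^esub> \<theta> (free_reduction w)))"
  using assms
proof (induction w arbitrary: g)
  case Nil
  then show ?case
    by (simp add: free_reduction_Nil transversal)
next
  case (Cons a u)
  have a: "a \<in> letters" and u: "u \<in> words X" using Cons.prems by (auto simp: Cons_words)
  note c = letter_closed[OF a] free_reduction_in_carrier[OF u]
  have g: "g \<otimes>\<^bsub>G\<^esub> \<theta> (free_reduction (a # u)) = next_state g a \<otimes>\<^bsub>G\<^esub> \<theta> (free_reduction u)"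
    using c Cons.prems(2) by (simp add: free_reduction_Cons next_state_def G.m_assoc)
  have n: "next_state g a \<in> carrier G" by (rule next_state_closed[OF Cons.prems(2) a])
  let ?t = "transversal (next_state g a)" and ?e = "finv (transversal (next_state g a \<otimes>\<^bsub>G\<^esub> \<theta> (free_reduction u)))"
  have t: "?t \<in> carrier F" "?e \<in> carrier F" "transversal g \<in> carrier F"
    using n c Cons.prems(2) by (auto intro!: transversal_closed F.inv_closed)
  have "bd (lift_word (a # u) g) = schreier g a \<cdot> (?t \<cdot> free_reduction u \<cdot> ?e)"
    using Cons.IH[OF u n] lift_letter_closed[OF Cons.prems(2) a] lift_word_closed[OF u n]
    by (simp add: bd_lift_letter[OF Cons.prems(2) a])
  also have "\<dots> = transversal g \<cdot> ([a] \<cdot> (finv ?t \<cdot> (?t \<cdot> (free_reduction u \<cdot> ?e))))"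
    using t c unfolding schreier_def by (simp add: F.m_assoc)
  also have "finv ?t \<cdot> (?t \<cdot> (free_reduction u \<cdot> ?e)) = free_reduction u \<cdot> ?e"
    using t c by (simp add: F.m_assoc[symmetric])
  also have "transversal g \<cdot> ([a] \<cdot> (free_reduction u \<cdot> ?e)) =
      transversal g \<cdot> free_reduction (a # u) \<cdot> ?e"
    using t c by (simp add: free_reduction_Cons F.m_assoc)
  finally show ?case by (simp only: g)
qed

abbreviation section_map where
  "section_map n \<equiv> lift_word n \<one>\<^bsub>G\<^esub>"

lemma kernel_words:
  assumes "n \<in> N"
  shows "n \<in> words X" "free_reduction n = n" "\<theta> n = \<one>\<^bsub>G\<^esub>"
  using assms free_reduction_reduced by (auto simp: kernel_def free_group_def)

lemma section_map_closed: "n \<in> N \<Longrightarrow> section_map n \<in> carrier C"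
  by (simp add: lift_word_closed kernel_words)

lemma bd_section_map: "n \<in> N \<Longrightarrow> bd (section_map n) = n"
  using N_closed[of n] by (simp add: bd_lift_word kernel_words transversal_def)

lemma section_map_mult:
  assumes "m \<in> N" "n \<in> N"
  shows "section_map (m \<cdot> n) = section_map m \<otimes>\<^bsub>C\<^esub> section_map n"
proof -
  have "m \<cdot> n = foldr cancel_cons m n"
    using N_closed[OF assms(2)] by (intro free_group_mult_eq) (simp add: free_group_def)
  then show ?thesis
    using assms by (simp add: lift_word_foldr lift_word_append kernel_words)
qed

section \<open>Retraction onto the kernel, and injectivity of the count there\<close>

definition retraction where
  "retraction c = c \<otimes>\<^bsub>C\<^esub> inv\<^bsub>C\<^esub> section_map (bd c)"

lemma bd_in_N: "c \<in> carrier C \<Longrightarrow> bd c \<in> N"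
  using bd_image by (metis imageI)

lemma retraction_in_K: "c \<in> carrier C \<Longrightarrow> retraction c \<in> K"
  using section_map_closed[OF bd_in_N[of c]] bd_section_map[OF bd_in_N[of c]]
  by (simp add: retraction_def kernel_def)

text \<open>Multiplicativity uses that \<open>K\<close> is central: \<open>retraction y\<close> is
  moved past the inverse of the section value belonging to \<open>x\<close>.\<close>

lemma retraction_hom: "retraction \<in> hom C (C\<lparr>carrier := K\<rparr>)"
proof (rule homI)
  fix x assume x: "x \<in> carrier C"
  show "retraction x \<in> carrier (C\<lparr>carrier := K\<rparr>)" using retraction_in_K[OF x] by simp
  fix y assume y: "y \<in> carrier C"
  let ?s = "section_map (bd x)" and ?t = "section_map (bd y)"
  have c: "?s \<in> carrier C" "?t \<in> carrier C" using x y by (simp_all add: section_map_closed bd_in_N)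
  have r: "retraction y \<in> carrier C" using retraction_in_K[OF y] by (simp add: kernel_def)
  have "retraction (x \<otimes>\<^bsub>C\<^esub> y) = x \<otimes>\<^bsub>C\<^esub> y \<otimes>\<^bsub>C\<^esub> inv\<^bsub>C\<^esub> (?s \<otimes>\<^bsub>C\<^esub> ?t)"
    using x y by (simp add: retraction_def section_map_mult bd_in_N)
  also have "\<dots> = x \<otimes>\<^bsub>C\<^esub> (retraction y \<otimes>\<^bsub>C\<^esub> inv\<^bsub>C\<^esub> ?s)"
    using x y c by (simp add: retraction_def C.m_assoc C.inv_mult_group)
  also have "retraction y \<otimes>\<^bsub>C\<^esub> inv\<^bsub>C\<^esub> ?s = inv\<^bsub>C\<^esub> ?s \<otimes>\<^bsub>C\<^esub> retraction y"
    using K_central[OF retraction_in_K[OF y] C.inv_closed[OF c(1)]] .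
  also have "x \<otimes>\<^bsub>C\<^esub> (inv\<^bsub>C\<^esub> ?s \<otimes>\<^bsub>C\<^esub> retraction y) = retraction x \<otimes>\<^bsub>C\<^esub> retraction y"
    using x c r by (simp add: retraction_def[of x] C.m_assoc)
  finally show "retraction (x \<otimes>\<^bsub>C\<^esub> y) = retraction x \<otimes>\<^bsub>C\<lparr>carrier := K\<rparr>\<^esub> retraction y" by simp
qed

lemma retraction_K:
  assumes "c \<in> K" shows "retraction c = c"
  using assms by (simp add: retraction_def kernel_def one_F)

text \<open>\<open>q\<close> and \<open>q'\<close> differ by an element of \<open>N\<close>, which
  is the boundary of some \<open>c\<close>; by \<open>gen_swap\<close> the two generators are then
  conjugate under \<open>c\<close>. A homomorphism to an abelian group does not distinguish
  conjugates.\<close>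

lemma retraction_gen:
  assumes y: "(q, i) \<in> labels" and q': "q' \<in> carrier F" "\<theta> q = \<theta> q'"
  shows "retraction (gen (q, i)) = retraction (gen (q', i))"
proof -
  interpret KK: comm_group "C\<lparr>carrier := K\<rparr>" by (rule comm_group_K)
  have q: "q \<in> carrier F" using y by (simp add: labels_def)
  have "finv q \<cdot> q' \<in> N" using q q' by (simp add: kernel_def)
  then obtain c where c: "c \<in> carrier C" "bd c = finv q \<cdot> q'" using bd_lift by metis
  obtain w where w: "w \<in> label_words" "c = cls w" using c(1) by (rule crossed_module_cases)
  have y': "(q', i) \<in> labels" using y q' by (simp add: labels_def)
  have "q \<cdot> (finv q \<cdot> q') = q'" using q q' by (simp add: F.m_assoc[symmetric])
  then have "translate (word_boundary w) (q, i) = (q', i)"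
    using c(2) w by (simp add: bd_cls)
  then have "gen (q, i) \<otimes>\<^bsub>C\<^esub> c = c \<otimes>\<^bsub>C\<^esub> gen (q', i)"
    using gen_swap[OF w(1) y] w(2) by (simp only:)
  moreover have g: "gen (q, i) \<in> carrier C" "gen (q', i) \<in> carrier C"
    using y y' by (simp_all del: translate.simps)
  ultimately have "retraction (gen (q, i)) \<otimes>\<^bsub>C\<^esub> retraction c = retraction c \<otimes>\<^bsub>C\<^esub> retraction (gen (q', i))"
    using hom_mult[OF retraction_hom g(1) c(1)] hom_mult[OF retraction_hom c(1) g(2)] by simp
  also have "\<dots> = retraction (gen (q', i)) \<otimes>\<^bsub>C\<^esub> retraction c"
    using K_central[OF retraction_in_K[OF c(1)]] retraction_in_K[OF g(2)] by (simp add: kernel_def)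
  finally show ?thesis
    using retraction_in_K[OF g(1)] retraction_in_K[OF g(2)] retraction_in_K[OF c(1)]
    by (simp add: kernel_def)
qed

text \<open>The retraction onto the abelian group \<open>K\<close> factors through the abelianization of the crossed
  module, which is the free module.\<close>

lemma K_count_injective:
  assumes "c \<in> K" "count c = \<one>\<^bsub>free_gmodule R G\<^esub>"
  shows "c = \<one>\<^bsub>C\<^esub>"
proof -
  interpret KK: comm_group "C\<lparr>carrier := K\<rparr>" by (rule comm_group_K)
  have closed: "retraction (gen (transversal g, i)) \<in> carrier (C\<lparr>carrier := K\<rparr>)"
    if "i \<in> R" "g \<in> carrier G" for i g
  proof -
    have "(transversal g, i) \<in> labels" using that transversal_closed by (simp add: labels_def)
    then have "gen (transversal g, i) \<in> carrier C" by simp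
    then show ?thesis using retraction_in_K by simp
  qed
  \<comment> \<open>\<open>h\<close> is prescribed on one label per basis element; by
    \<open>retraction_gen\<close> all labels with that basis element have the same value. So
    \<open>h\<close> after \<open>count\<close> agrees with the retraction on generators, and on
    \<open>K\<close> the retraction is the identity.\<close>
  obtain h where h: "h \<in> hom (free_gmodule R G) (C\<lparr>carrier := K\<rparr>)"
    "\<And>i g. i \<in> R \<Longrightarrow> g \<in> carrier G \<Longrightarrow> h (free_basis R i g) = retraction (gen (transversal g, i))"
  proof (rule free_gmodule_universal[of _ R G "\<lambda>i g. retraction (gen (transversal g, i))"])
    show "comm_group (C\<lparr>carrier := K\<rparr>)" by (rule comm_group_K)
  qed (erule (1) closed, rule that)
  have cC: "c \<in> carrier C" using assms(1) by (simp add: kernel_def)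
  then obtain w where w: "w \<in> label_words" "c = cls w" by (rule crossed_module_cases)
  have w': "fst ` set w \<subseteq> labels" using w by (simp add: label_words_iff)
  have gen: "gen \<in> labels \<rightarrow> carrier C" by (intro Pi_I) simp
  have "h (count c) = KK.path_value (\<lambda>y. h (label_basis y)) w"
    using M.path_value_hom[OF KK.group_axioms h(1) w'] label_basis_funcset w by (simp add: count_cls)
  also have "\<dots> = KK.path_value (\<lambda>y. retraction (gen y)) w"
  proof (rule KK.path_value_cong[OF w'])
    fix y assume y: "y \<in> labels"
    obtain q i where qi: "y = (q, i)" by (cases y)
    have q: "q \<in> carrier F" "i \<in> R" using y qi by (auto simp: labels_def)
    have "h (label_basis y) = retraction (gen (transversal (\<theta> q), i))"
      using q h(2)[of i "\<theta> q"] by (simp add: qi)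
    also have "\<dots> = retraction (gen y)"
      using retraction_gen[of q i "transversal (\<theta> q)"] y q transversal[of "\<theta> q"] by (simp add: qi)
    finally show "h (label_basis y) = retraction (gen y)" .
  qed
  also have "\<dots> = retraction (C.path_value gen w)"
    by (rule C.path_value_hom[OF KK.group_axioms retraction_hom w' gen, symmetric])
  also have "\<dots> = c" using w assms(1) by (simp add: path_value_gen retraction_K)
  finally have "c = h \<one>\<^bsub>free_gmodule R G\<^esub>" using assms(2) by simp
  also have "\<dots> = \<one>\<^bsub>C\<^esub>"
    using hom_one[OF h(1) M.group_axioms KK.group_axioms] by simp
  finally show ?thesis .
qed

end

section \<open>Paths in the reduced Squier complex\<close>

context presentation
begin

abbreviation Sq :: "('x word, 'x sq_edge) two_complex" where
  "Sq \<equiv> squier_complex X R"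

lemma squier_simps:
  "verts Sq = carrier F"
  "(p, l, r, q) \<in> edges Sq \<longleftrightarrow> p \<in> carrier F \<and> q \<in> carrier F \<and> (l, r) \<in> R"
  "src Sq (p, l, r, q) = p \<cdot> free_reduction l \<cdot> q"
  "tgt Sq (p, l, r, q) = p \<cdot> free_reduction r \<cdot> q"
  by (simp_all add: squier_complex_def Let_def)

fun edge_label :: "'x sq_edge \<Rightarrow> 'x word \<times> 'x word \<times> 'x word" where
  "edge_label (p, l, r, q) = (q, l, r)"

definition path_labels :: "'x sq_edge path \<Rightarrow> ('x word \<times> 'x word \<times> 'x word) path" where
  "path_labels = map (\<lambda>(e, s). (edge_label e, s))"

lemma path_labels_simps [simp]:
  "path_labels [] = []"
  "path_labels ((e, s) # a) = (edge_label e, s) # path_labels a"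
  by (simp_all add: path_labels_def)

text \<open>The first component solves \<open>p l q = v\<close>, or \<open>p r q = v\<close> if the
  edge is traversed backwards: it is the unique edge with the given label and direction leaving
  \<open>v\<close>.\<close>

fun lift_edge :: "'x word \<Rightarrow> 'x word \<times> 'x word \<times> 'x word \<Rightarrow> bool \<Rightarrow> 'x sq_edge" where
  "lift_edge v (q, l, r) s = (v \<cdot> finv q \<cdot> finv (free_reduction (if s then l else r)), l, r, q)"

fun lift_path :: "'x word \<Rightarrow> ('x word \<times> 'x word \<times> 'x word) path \<Rightarrow> 'x sq_edge path" where
  "lift_path v [] = []"
| "lift_path v ((y, s) # w) = (lift_edge v y s, s) # lift_path (v \<cdot> F.signed (boundary y) s) w"

lemma F_cancel:
  assumes "a \<in> carrier F" "b \<in> carrier F"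
  shows "finv a \<cdot> (a \<cdot> b) = b" "a \<cdot> (finv a \<cdot> b) = b"
  using assms by (simp_all add: F.m_assoc[symmetric])

lemma edge_label_closed:
  assumes "e \<in> edges Sq" shows "edge_label e \<in> labels"
  using assms by (cases e) (simp add: squier_simps labels_def)

lemma lift_edge:
  assumes v: "v \<in> carrier F" and "y \<in> labels"
  shows "lift_edge v y s \<in> edges Sq"
    and "(if s then src Sq (lift_edge v y s) else tgt Sq (lift_edge v y s)) = v"
    and "(if s then tgt Sq (lift_edge v y s) else src Sq (lift_edge v y s)) =
      v \<cdot> F.signed (boundary y) s"
    and "edge_label (lift_edge v y s) = y"
proof -
  obtain q l r where y: "y = (q, l, r)" and c: "q \<in> carrier F" "(l, r) \<in> R"
    "free_reduction l \<in> carrier F" "free_reduction r \<in> carrier F"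
    using assms(2) by (rule labels_cases)
  show "lift_edge v y s \<in> edges Sq" using v c by (simp add: y squier_simps)
  show "(if s then src Sq (lift_edge v y s) else tgt Sq (lift_edge v y s)) = v"
    using v c by (simp add: y squier_simps F.m_assoc)
  show "(if s then tgt Sq (lift_edge v y s) else src Sq (lift_edge v y s)) =
      v \<cdot> F.signed (boundary y) s"
    using v c by (simp add: y squier_simps F.m_assoc F.inv_mult_group)
  show "edge_label (lift_edge v y s) = y" by (simp add: y)
qed

lemma lift_edge_edge_label:
  assumes "e \<in> edges Sq"
  shows "lift_edge (if s then src Sq e else tgt Sq e) (edge_label e) s = e"
proof -
  obtain p l r q where e: "e = (p, l, r, q)" by (cases e)
  have c: "p \<in> carrier F" "q \<in> carrier F" "free_reduction l \<in> carrier F" "free_reduction r \<in> carrier F"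
    using assms rho_closed[of l r] by (simp_all add: e squier_simps)
  then show ?thesis by (simp add: e squier_simps F.m_assoc F_cancel)
qed

lemma signed_boundary_closed:
  "y \<in> labels \<Longrightarrow> F.signed (boundary y) s \<in> carrier F"
  by (rule F.signed_closed) (rule boundary_closed)

lemma lift_path_append:
  assumes "u \<in> label_words" "v \<in> carrier F"
  shows "lift_path v (u @ w) = lift_path v u @ lift_path (v \<cdot> word_boundary u) w"
  using assms
proof (induction u arbitrary: v)
  case (Cons x u)
  obtain y s where x: "x = (y, s)" by (cases x)
  have y: "y \<in> labels" and u: "u \<in> label_words" using Cons.prems x by simp_all
  note b = signed_boundary_closed[OF y, of s]
  have "v \<cdot> F.signed (boundary y) s \<cdot> word_boundary u = v \<cdot> word_boundary (x # u)"
    using b u Cons.prems(2) by (simp add: x F.m_assoc del: F.signed.simps)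
  then show ?case
    using Cons.IH[OF u F.m_closed[OF Cons.prems(2) b]] by (simp add: x del: F.signed.simps)
qed simp

lemma is_path_lift_path:
  assumes "w \<in> label_words" "v \<in> carrier F"
  shows "is_path Sq v (lift_path v w) (v \<cdot> word_boundary w)" "path_labels (lift_path v w) = w"
proof -
  have "is_path Sq v (lift_path v w) (v \<cdot> word_boundary w) \<and> path_labels (lift_path v w) = w"
    using assms
  proof (induction w arbitrary: v)
    case Nil
    then show ?case by (simp add: squier_simps)
  next
    case (Cons x w)
    obtain y s where x: "x = (y, s)" by (cases x)
    have y: "y \<in> labels" and w: "w \<in> label_words" using Cons.prems x by simp_all
    note b = signed_boundary_closed[OF y, of s]
    have "v \<cdot> F.signed (boundary y) s \<cdot> word_boundary w = v \<cdot> word_boundary (x # w)"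
      using b w Cons.prems(2) by (simp add: x F.m_assoc del: F.signed.simps)
    then show ?case
      using Cons.IH[OF w F.m_closed[OF Cons.prems(2) b]] lift_edge[OF Cons.prems(2) y, of s] Cons.prems(2)
      unfolding x lift_path.simps is_path.simps path_labels_simps by (simp only: squier_simps)
  qed
  then show "is_path Sq v (lift_path v w) (v \<cdot> word_boundary w)" "path_labels (lift_path v w) = w"
    by simp_all
qed

text \<open>Uniqueness of path lifting: start and labels determine a path, and its end is the start
  times the boundary of the labels. In particular, loops at 1 correspond to words of boundary
  1.\<close>

lemma is_path_squier:
  assumes "is_path Sq v a w"
  shows "path_labels a \<in> label_words" "lift_path v (path_labels a) = a"
    "w = v \<cdot> word_boundary (path_labels a)"
proof -
  have "path_labels a \<in> label_words \<and> lift_path v (path_labels a) = a \<and>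
      w = v \<cdot> word_boundary (path_labels a)"
    using assms
  proof (induction a arbitrary: v)
    case Nil
    then have "v \<in> carrier F \<and> v = w" unfolding is_path.simps squier_simps .
    then have "v \<in> carrier F" "v = w" by (rule conjunct1, rule conjunct2)
    then show ?case by simp
  next
    case (Cons x a)
    obtain e s where x: "x = (e, s)" by (cases x)
    let ?u = "if s then tgt Sq e else src Sq e"
    have "v \<in> carrier F \<and> e \<in> edges Sq \<and> v = (if s then src Sq e else tgt Sq e) \<and> is_path Sq ?u a w"
      using Cons.prems unfolding x is_path.simps squier_simps .
    then have v: "v \<in> carrier F" and e: "e \<in> edges Sq"
      and vs: "v = (if s then src Sq e else tgt Sq e)" and p: "is_path Sq ?u a w"
      by metis+
    note y = edge_label_closed[OF e]
    note b = signed_boundary_closed[OF y, of s]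
    have le: "lift_edge v (edge_label e) s = e" unfolding vs by (rule lift_edge_edge_label[OF e])
    have u: "?u = v \<cdot> F.signed (boundary (edge_label e)) s"
      using lift_edge(3)[OF v y, of s] unfolding le .
    have IH: "path_labels a \<in> label_words" "lift_path ?u (path_labels a) = a"
        "w = ?u \<cdot> word_boundary (path_labels a)"
      using Cons.IH[OF p] by simp_all
    have "w = v \<cdot> word_boundary (path_labels (x # a))"
      using IH(3) b v word_boundary_closed[OF IH(1)] unfolding u
      by (simp add: x F.m_assoc del: F.signed.simps)
    moreover have "lift_path v (path_labels (x # a)) = x # a"
      using IH(2) unfolding u by (simp add: x le del: F.signed.simps)
    moreover have "path_labels (x # a) \<in> label_words" using y IH(1) by (simp add: x)
    ultimately show ?case by simp
  qed
  then show "path_labels a \<in> label_words" "lift_path v (path_labels a) = a"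
    "w = v \<cdot> word_boundary (path_labels a)" by simp_all
qed

lemma lift_cell:
  assumes v: "v \<in> carrier F" and cd: "(c, d) \<in> cells peiffer_complex"
  shows "(lift_path v c, lift_path v d) \<in> cells Sq"
  using cd
proof (rule cells_peifferE)
  fix y z assume y: "y \<in> labels" and z: "z \<in> labels" and c: "c = [(y, True), (z, True)]"
    and d: "d = [(z, True), (translate (boundary z) y, True)]"
  obtain u l r where y': "y = (u, l, r)" and yc: "u \<in> carrier F" "(l, r) \<in> R"
    "free_reduction l \<in> carrier F" "free_reduction r \<in> carrier F"
    using y by (rule labels_cases)
  obtain q' l' r' where z': "z = (q', l', r')" and zc: "q' \<in> carrier F" "(l', r') \<in> R"
    "free_reduction l' \<in> carrier F" "free_reduction r' \<in> carrier F"
    using z by (rule labels_cases)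
  \<comment> \<open>The parameters of the 2-cell solve \<open>p l u = v\<close> and
    \<open>q p' l' q' = u\<close>. Only the product \<open>q p'\<close> enters, so \<open>p'\<close>
    is taken to be 1.\<close>
  let ?p = "v \<cdot> finv u \<cdot> finv (free_reduction l)"
  let ?q = "u \<cdot> finv q' \<cdot> finv (free_reduction l')"
  have p: "?p \<in> carrier F" "?q \<in> carrier F" using v yc zc by simp_all
  note simps = F.m_assoc F.inv_mult_group F_cancel
  have "lift_path v c = [((?p, l, r, ?q \<cdot> \<one>\<^bsub>F\<^esub> \<cdot> free_reduction l' \<cdot> q'), True),
      ((?p \<cdot> free_reduction r \<cdot> ?q \<cdot> \<one>\<^bsub>F\<^esub>, l', r', q'), True)]"
    using v yc zc by (simp add: c y' z' simps)
  moreover have "lift_path v d = [((?p \<cdot> free_reduction l \<cdot> ?q \<cdot> \<one>\<^bsub>F\<^esub>, l', r', q'), True),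
      ((?p, l, r, ?q \<cdot> \<one>\<^bsub>F\<^esub> \<cdot> free_reduction r' \<cdot> q'), True)]"
    using v yc zc by (simp add: d y' z' simps)
  ultimately have "(lift_path v c, lift_path v d) =
      ([((?p, l, r, ?q \<cdot> \<one>\<^bsub>F\<^esub> \<cdot> free_reduction l' \<cdot> q'), True),
        ((?p \<cdot> free_reduction r \<cdot> ?q \<cdot> \<one>\<^bsub>F\<^esub>, l', r', q'), True)],
       [((?p \<cdot> free_reduction l \<cdot> ?q \<cdot> \<one>\<^bsub>F\<^esub>, l', r', q'), True),
        ((?p, l, r, ?q \<cdot> \<one>\<^bsub>F\<^esub> \<cdot> free_reduction r' \<cdot> q'), True)])"
    by (simp only:)
  moreover note p yc(2) zc(1,2) F.one_closed
  ultimately show ?thesis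
    unfolding squier_complex_def Let_def two_complex.simps mem_Collect_eq
    by - (rule exI[of _ ?p], rule exI[of _ l], rule exI[of _ r], rule exI[of _ ?q],
        rule exI[of _ "\<one>\<^bsub>F\<^esub>"], rule exI[of _ l'], rule exI[of _ r'],
        rule exI[of _ q'], intro conjI)
qed

text \<open>Going back along the same label retraces the same edge, so backtracking pairs lift to
  backtracking pairs.\<close>

lemma lift_edge_inverse:
  assumes v: "v \<in> carrier F" and "y \<in> labels"
  shows "lift_edge (v \<cdot> F.signed (boundary y) s) y (\<not> s) = lift_edge v y s"
proof -
  obtain q l r where y: "y = (q, l, r)" and c: "q \<in> carrier F" "(l, r) \<in> R"
    "free_reduction l \<in> carrier F" "free_reduction r \<in> carrier F"
    using assms(2) by (rule labels_cases)
  show ?thesis using v c by (cases s) (simp_all add: y F.m_assoc F.inv_mult_group)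
qed

lemma homotopy_step_lift_path:
  assumes v: "v \<in> carrier F" and a: "a \<in> label_words" and b: "b \<in> label_words"
    and step: "homotopy_step peiffer_complex a b"
  shows "homotopy_step Sq (lift_path v a) (lift_path v b)"
  using step
proof cases
  case (backtrack p y s q)
  have p: "p \<in> label_words" and y: "y \<in> labels"
    using a unfolding backtrack(1) by (simp_all add: label_words_iff image_Un)
  let ?v = "v \<cdot> word_boundary p" and ?b = "F.signed (boundary y) s"
  have c: "?v \<in> carrier F" "?b \<in> carrier F"
    using v p signed_boundary_closed[OF y, of s] by (simp_all del: F.signed.simps)
  have yy: "[(y, s), (y, \<not> s)] \<in> label_words" using y by simp
  \<comment> \<open>The pair has trivial boundary, so the lift of the remaining word
    \<open>q\<close> starts at \<open>?v\<close> with or without it.\<close>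
  have "F.signed (boundary y) (\<not> s) = finv ?b" using y by simp
  then have "word_boundary [(y, s), (y, \<not> s)] = \<one>\<^bsub>F\<^esub>"
    using c(2) by (simp del: F.signed.simps)
  moreover have "lift_path ?v [(y, s), (y, \<not> s)] = [(lift_edge ?v y s, s), (lift_edge ?v y s, \<not> s)]"
    by (simp only: lift_path.simps lift_edge_inverse[OF c(1) y])
  ultimately have "lift_path v a = lift_path v p @ [(lift_edge ?v y s, s), (lift_edge ?v y s, \<not> s)] @ lift_path ?v q"
    unfolding backtrack(1) lift_path_append[OF p v] lift_path_append[OF yy c(1)]
    using c(1) by (simp only: F.r_one)
  then show ?thesis
    unfolding backtrack(2) lift_path_append[OF p v] by (simp only: homotopy_step.backtrack)
next
  case (cell c d p q)
  have p: "p \<in> label_words" and c: "c \<in> label_words" and d: "d \<in> label_words"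
    using a b unfolding cell(1,2) by (simp_all add: label_words_iff image_Un)
  have v': "v \<cdot> word_boundary p \<in> carrier F" using v p by simp
  \<comment> \<open>Both sides of a 2-cell have the same boundary, so the lift of \<open>q\<close>
    starts at the same vertex after either.\<close>
  show ?thesis
    unfolding cell(1,2) lift_path_append[OF p v] lift_path_append[OF c v'] lift_path_append[OF d v']
      word_boundary_cells[OF cell(3)]
    by (rule homotopy_step.cell[OF lift_cell[OF v' cell(3)]])
qed

abbreviation squier_loops :: "'x sq_edge path set" where
  "squier_loops \<equiv> loops Sq []"

lemma Nil_closed: "[] \<in> carrier F"
  using F.one_closed by (simp only: one_F)

lemma Nil_mult: "u \<in> carrier F \<Longrightarrow> [] \<cdot> u = u"
  using F.l_one by (simp only: one_F)

lemma squier_loops_labels: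
  assumes "a \<in> squier_loops"
  shows "path_labels a \<in> label_words" "lift_path [] (path_labels a) = a"
    "word_boundary (path_labels a) = []"
proof -
  have p: "is_path Sq [] a []" using assms by (simp add: loops_def)
  show "path_labels a \<in> label_words" "lift_path [] (path_labels a) = a"
    by (rule is_path_squier[OF p])+
  show "word_boundary (path_labels a) = []"
    using is_path_squier(3)[OF p] Nil_mult[OF word_boundary_closed[OF is_path_squier(1)[OF p]]] by (rule trans[symmetric])
qed

lemma lift_path_loop:
  assumes "w \<in> label_words" "word_boundary w = []"
  shows "lift_path [] w \<in> squier_loops" "path_labels (lift_path [] w) = w"
  using is_path_lift_path[OF assms(1) Nil_closed] Nil_mult[OF Nil_closed]
  by (simp_all add: assms(2) loops_def)

text \<open>Homotopies lift along the covering step by step. The boundary is invariant under each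
  step, so all intermediate words keep boundary 1 and lift to loops.\<close>

lemma squier_homotopy_lift:
  assumes a: "a \<in> squier_loops" and b: "b \<in> squier_loops"
    and hom: "(path_labels a, path_labels b) \<in> loop_homotopy peiffer_complex ()"
  shows "(a, b) \<in> loop_homotopy Sq []"
proof -
  have "(lift_path [] (path_labels a), lift_path [] (path_labels b)) \<in> loop_homotopy Sq []"
    using hom
  proof (rule loop_homotopy_map[where Q = "\<lambda>w. word_boundary w = []"])
    show "word_boundary (path_labels a) = []" by (rule squier_loops_labels(3)[OF a])
    fix x y assume xy: "x \<in> label_words" "y \<in> label_words" "homotopy_step peiffer_complex x y"
    then have "(x, y) \<in> loop_homotopy peiffer_complex ()"
      unfolding loop_homotopy_def by (simp add: r_into_equivclp)
    then have "word_boundary x = word_boundary y"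
      by (rule F.path_value_loop_homotopy[OF boundary_funcset, rotated]) (rule word_boundary_cells)
    then show "(word_boundary x = []) = (word_boundary y = [])" by simp
    show "homotopy_step Sq (lift_path [] x) (lift_path [] y)"
      by (rule homotopy_step_lift_path[OF Nil_closed xy])
  qed (rule lift_path_loop(1))
  then show ?thesis by (simp only: squier_loops_labels(2)[OF a] squier_loops_labels(2)[OF b])
qed

end

section \<open>The exact sequence\<close>

text \<open>Collapses the unions by which the actions on classes are defined. The members
  \<open>i\<close> and \<open>j\<close> rule out an empty union.\<close>

lemma UN_eq_const:
  assumes "i \<in> I" "j \<in> J" "\<And>i j. i \<in> I \<Longrightarrow> j \<in> J \<Longrightarrow> f i j = c"
  shows "(\<Union>i\<in>I. \<Union>j\<in>J. f i j) = c"
  using assms by fastforce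

context presentation
begin

abbreviation sq_cls :: "'x sq_edge path \<Rightarrow> 'x sq_edge path set" where
  "sq_cls \<equiv> loop_class Sq []"

abbreviation edge_basis :: "'x sq_edge \<Rightarrow> 'x word \<times> 'x word \<Rightarrow> ('g \<Rightarrow>\<^sub>0 int)" where
  "edge_basis e \<equiv> label_basis (edge_label e)"

abbreviation \<phi> :: "'x sq_edge path set \<Rightarrow> 'x word \<times> 'x word \<Rightarrow> ('g \<Rightarrow>\<^sub>0 int)" where
  "\<phi> \<equiv> M.class_value edge_basis"

lemma edge_basis_funcset: "edge_basis \<in> edges Sq \<rightarrow> carrier (free_gmodule R G)"
  by (intro Pi_I label_basis_closed edge_label_closed)

lemma path_value_edge_basis: "M.path_value edge_basis a = word_count (path_labels a)"
  by (simp only: path_labels_def M.path_value_map)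

text \<open>The two sides carry the same labels in opposite order, except that
  \<open>q p' l' q'\<close> becomes \<open>q p' r' q'\<close>; these agree under \<theta> because
  \<theta> identifies \<open>l'\<close> and \<open>r'\<close>.\<close>

lemma edge_basis_cells:
  assumes "(c, d) \<in> cells Sq" shows "M.path_value edge_basis c = M.path_value edge_basis d"
proof -
  obtain p l r q p' l' r' q' where
    cd: "(c, d) = ([((p, l, r, q \<cdot> p' \<cdot> free_reduction l' \<cdot> q'), True),
        ((p \<cdot> free_reduction r \<cdot> q \<cdot> p', l', r', q'), True)],
       [((p \<cdot> free_reduction l \<cdot> q \<cdot> p', l', r', q'), True),
        ((p, l, r, q \<cdot> p' \<cdot> free_reduction r' \<cdot> q'), True)])"
    and F: "p \<in> carrier F" "q \<in> carrier F" "p' \<in> carrier F" "q' \<in> carrier F"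
    and R: "(l, r) \<in> R" "(l', r') \<in> R"
    using assms unfolding squier_complex_def Let_def two_complex.simps mem_Collect_eq by metis
  note c = rho_closed[OF R(2)]
  let ?u = "q \<cdot> p' \<cdot> free_reduction l' \<cdot> q'" and ?v = "q \<cdot> p' \<cdot> free_reduction r' \<cdot> q'"
  have "\<theta> ?u = \<theta> ?v" using F c \<theta>_relation[OF R(2)] by simp
  then have uv: "label_basis (?u, l, r) = label_basis (?v, l, r)" by (simp only: label_basis.simps)
  have "(?v, l, r) \<in> labels" "(q', l', r') \<in> labels" using F R c by (simp_all add: labels_def)
  note b = this[THEN label_basis_closed]
  have "c = [((p, l, r, ?u), True), ((p \<cdot> free_reduction r \<cdot> q \<cdot> p', l', r', q'), True)]"
    "d = [((p \<cdot> free_reduction l \<cdot> q \<cdot> p', l', r', q'), True), ((p, l, r, ?v), True)]"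
    using cd by (simp_all only: prod.inject)
  then show ?thesis
    by (simp only: M.path_value.simps M.signed.simps if_True edge_label.simps uv M.r_one b
        M.m_comm[OF b])
qed

lemma \<phi>_cls: "a \<in> squier_loops \<Longrightarrow> \<phi> (sq_cls a) = word_count (path_labels a)"
  unfolding path_value_edge_basis[symmetric]
  by (rule M.class_value_loop_class[OF edge_basis_funcset edge_basis_cells])

end

sublocale presentation \<subseteq> P: group "squier_pi1 X R"
  by (rule group_fundamental_group) (simp only: squier_simps Nil_closed)

sublocale presentation \<subseteq> \<phi>: group_hom "squier_pi1 X R" "free_gmodule R G" \<phi>
  by unfold_locales (rule M.class_value_hom[OF edge_basis_funcset edge_basis_cells])

context presentation
begin

text \<open>The labels of a loop form an element of \<open>K\<close>. If its count vanishes, the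
  label word is null-homotopic by \<open>K_count_injective\<close>, and this homotopy lifts to the
  Squier complex.\<close>

lemma \<phi>_inj: "inj_on \<phi> (carrier (squier_pi1 X R))"
  unfolding \<phi>.inj_on_one_iff
proof (intro allI impI)
  fix \<alpha> assume "\<alpha> \<in> carrier (squier_pi1 X R)" and one: "\<phi> \<alpha> = \<one>\<^bsub>free_gmodule R G\<^esub>"
  then obtain a where a: "a \<in> squier_loops" and \<alpha>: "\<alpha> = sq_cls a"
    unfolding fundamental_group_carrier by (elim imageE)
  let ?w = "path_labels a"
  note w = squier_loops_labels[OF a]
  have "bd (cls ?w) = \<one>\<^bsub>F\<^esub>" by (simp only: bd_cls[OF w(1)] w(3) one_F)
  then have "cls ?w \<in> K" using cls_closed[OF w(1)] unfolding kernel_def by (intro CollectI conjI)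
  moreover have "count (cls ?w) = \<one>\<^bsub>free_gmodule R G\<^esub>"
    using one unfolding count_cls[OF w(1)] \<alpha> \<phi>_cls[OF a] .
  ultimately have "cls ?w = cls []" unfolding cls_Nil by (rule K_count_injective)
  then have "(path_labels a, path_labels []) \<in> loop_homotopy peiffer_complex ()"
    using loop_class_eq_iff[OF w(1) Nil_label_words] by (simp only: path_labels_simps)
  moreover have nil: "[] \<in> squier_loops" unfolding loops_def using Nil_closed by (simp add: squier_simps)
  ultimately have "(a, []) \<in> loop_homotopy Sq []" using a by (intro squier_homotopy_lift)
  then show "\<alpha> = \<one>\<^bsub>squier_pi1 X R\<^esub>"
    unfolding \<alpha> fundamental_group_one using loop_class_eq_iff[OF a nil] by (simp only:)
qed

section \<open>The action on the fundamental group\<close>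

definition conj_path :: "'x word \<Rightarrow> 'x sq_edge path \<Rightarrow> 'x sq_edge path" where
  "conj_path q a = right_whisker X (left_whisker X (finv q) a) q"

lemma conj_path_simps:
  "conj_path u [] = []"
  "conj_path u (((p, l, r, q), s) # a) = ((finv u \<cdot> p, l, r, q \<cdot> u), s) # conj_path u a"
  by (simp_all add: conj_path_def left_whisker_def right_whisker_def)

text \<open>Whiskering on the left changes only the component \<open>p\<close>, which the label
  forgets.\<close>

lemma path_labels_conj_path: "path_labels (conj_path u a) = translate_word u (path_labels a)"
proof (induction a)
  case (Cons x a)
  obtain p l r q s where "x = ((p, l, r, q), s)" by (metis prod.collapse)
  then show ?case using Cons by (simp add: conj_path_simps translate_word_def)
qed (simp add: conj_path_simps translate_word_def)

lemma is_path_conj_path: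
  assumes "is_path Sq v a w" and u: "u \<in> carrier F"
  shows "is_path Sq (finv u \<cdot> v \<cdot> u) (conj_path u a) (finv u \<cdot> w \<cdot> u)"
  using assms(1)
proof (induction a arbitrary: v)
  case Nil
  then have "v \<in> carrier F \<and> v = w" unfolding is_path.simps squier_simps .
  then have "v \<in> carrier F" "v = w" by (rule conjunct1, rule conjunct2)
  then show ?case using u by (simp add: conj_path_simps squier_simps)
next
  case (Cons x a)
  obtain p l r q s where x: "x = ((p, l, r, q), s)" by (metis prod.collapse)
  let ?e = "(p, l, r, q)" and ?f = "(finv u \<cdot> p, l, r, q \<cdot> u)"
  have "v \<in> carrier F \<and> ?e \<in> edges Sq \<and> v = (if s then src Sq ?e else tgt Sq ?e) \<and>
      is_path Sq (if s then tgt Sq ?e else src Sq ?e) a w"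
    using Cons.prems unfolding x is_path.simps squier_simps(1) .
  then have v: "v \<in> carrier F" and e: "?e \<in> edges Sq"
    and vs: "v = (if s then src Sq ?e else tgt Sq ?e)"
    and path: "is_path Sq (if s then tgt Sq ?e else src Sq ?e) a w"
    by metis+
  have pq: "p \<in> carrier F" "q \<in> carrier F" "(l, r) \<in> R"
    using e by (simp_all add: squier_simps)
  note c = pq rho_closed[OF pq(3)]
  have "?f \<in> edges Sq" using c u by (simp add: squier_simps)
  moreover have "src Sq ?f = finv u \<cdot> src Sq ?e \<cdot> u" "tgt Sq ?f = finv u \<cdot> tgt Sq ?e \<cdot> u"
    using c u by (simp_all add: squier_simps F.m_assoc)
  moreover have "finv u \<cdot> v \<cdot> u \<in> carrier F" using u v by simp
  ultimately show ?case
    using Cons.IH[OF path] unfolding x conj_path_simps is_path.simps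
    by (cases s) (simp_all only: vs if_True if_False squier_simps(1) simp_thms)
qed

lemma conj_path_loop:
  assumes "a \<in> squier_loops" "u \<in> carrier F"
  shows "conj_path u a \<in> squier_loops"
proof -
  have "finv u \<cdot> [] \<cdot> u = []" using assms(2)
    by (simp only: one_F[symmetric] F.r_one F.inv_closed F.l_inv)
  then show ?thesis
    using is_path_conj_path[of "[]" a "[]" u] assms by (simp add: loops_def)
qed

lemma \<phi>_conj_path:
  assumes "a \<in> squier_loops" "u \<in> carrier F"
  shows "\<phi> (sq_cls (conj_path u a)) = free_gmodule_act R G (\<phi> (sq_cls a)) (\<theta> u)"
  unfolding \<phi>_cls[OF assms(1)] \<phi>_cls[OF conj_path_loop[OF assms]] path_labels_conj_path
  by (rule word_count_translate[OF squier_loops_labels(1)[OF assms(1)] assms(2)])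

lemma sq_cls_closed: "a \<in> squier_loops \<Longrightarrow> sq_cls a \<in> carrier (squier_pi1 X R)"
  unfolding fundamental_group_carrier by (rule imageI)

text \<open>Independence of both representatives is read off in the free module: the count of a
  conjugated loop depends only on the class of the loop and on \<theta> of the conjugating element,
  and \<phi> is injective.\<close>

lemma pi1_act_sq_cls:
  assumes a: "a \<in> squier_loops" and u: "u \<in> carrier F"
  shows "pi1_act X R \<theta> (sq_cls a) (\<theta> u) = sq_cls (conj_path u a)"
  unfolding pi1_act_def conj_path_def[symmetric]
proof (rule UN_eq_const)
  show "u \<in> {q \<in> carrier F. \<theta> q = \<theta> u}" using u by simp
  show "a \<in> sq_cls a" using loop_homotopy_refl[OF a] by simp
  fix q b assume q: "q \<in> {q \<in> carrier F. \<theta> q = \<theta> u}" and "b \<in> sq_cls a"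
  then have ab: "(a, b) \<in> loop_homotopy Sq []" by simp
  then have b: "b \<in> squier_loops" by (simp add: loop_homotopy_def)
  have q: "q \<in> carrier F" "\<theta> q = \<theta> u" using q by simp_all
  have "sq_cls a = sq_cls b" using loop_class_eq_iff[OF a b] ab by (simp only:)
  then have "\<phi> (sq_cls (conj_path q b)) = \<phi> (sq_cls (conj_path u a))"
    unfolding \<phi>_conj_path[OF a u] \<phi>_conj_path[OF b q(1)] by (simp only: q(2))
  then show "sq_cls (conj_path q b) = sq_cls (conj_path u a)"
    by (rule inj_onD[OF \<phi>_inj]) (intro sq_cls_closed conj_path_loop a b u q)+
qed

lemma \<phi>_gmodule_hom:
  "right_gmodule_hom G (squier_pi1 X R) (pi1_act X R \<theta>) (free_gmodule R G) (free_gmodule_act R G) \<phi>"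
proof (rule right_gmodule_hom_inj[OF right_gmodule_free_gmodule[OF group_G] P.group_axioms \<phi>.homh \<phi>_inj])
  fix x g assume "x \<in> carrier (squier_pi1 X R)" and "g \<in> carrier G"
  then obtain a u where a: "a \<in> squier_loops" "x = sq_cls a" and u: "u \<in> carrier F" "g = \<theta> u"
    unfolding fundamental_group_carrier \<theta>_surj[symmetric] by (elim imageE)
  show "pi1_act X R \<theta> x g \<in> carrier (squier_pi1 X R)"
    unfolding a u pi1_act_sq_cls[OF a(1) u(1)] by (intro sq_cls_closed conj_path_loop a u)
  show "\<phi> (pi1_act X R \<theta> x g) = free_gmodule_act R G (\<phi> x) g"
    unfolding a u pi1_act_sq_cls[OF a(1) u(1)] by (rule \<phi>_conj_path[OF a(1) u(1)])
qed

section \<open>The relation module and the map onto it\<close>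

abbreviation D :: "'x word set" where "D \<equiv> derived F N"

abbreviation N_group :: "'x word monoid" where "N_group \<equiv> F\<lparr>carrier := N\<rparr>"

abbreviation coset :: "'x word \<Rightarrow> 'x word set" where "coset n \<equiv> D #>\<^bsub>F\<^esub> n"

lemma subgroup_N: "subgroup N F"
  by (rule \<theta>.subgroup_kernel)

lemma derived_N_group: "derived N_group N = D"
  by (rule F.derived_consistent[OF subset_refl subgroup_N])

lemma normal_D: "D \<lhd> F"
  by (rule F.derived_is_normal[OF normal_N])

lemma normal_D_N: "D \<lhd> N_group"
  by (rule F.derived_subgroup_is_normal[OF subgroup_N])

lemma r_coset_N: "H #>\<^bsub>N_group\<^esub> n = H #>\<^bsub>F\<^esub> n"
  by (simp add: r_coset_def)

lemma relation_module_eq: "relation_module X G \<theta> = N_group Mod D"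
  by (simp add: relation_module_def abelianization_def derived_N_group)

lemma comm_group_relation_module: "comm_group (relation_module X G \<theta>)"
  using group.derived_quot_is_comm_group[OF F.subgroup_imp_group[OF subgroup_N]]
  by (simp add: relation_module_eq derived_N_group)

end

sublocale presentation \<subseteq> A: comm_group "relation_module X G \<theta>"
  by (rule comm_group_relation_module)

sublocale presentation \<subseteq> coset: group_hom "F\<lparr>carrier := kernel F G \<theta>\<rparr>" "relation_module X G \<theta>" coset
proof -
  interpret NG: group "F\<lparr>carrier := N\<rparr>" by (rule F.subgroup_imp_group[OF subgroup_N])
  show "group_hom (F\<lparr>carrier := N\<rparr>) (relation_module X G \<theta>) coset"
    using normal.r_coset_hom_Mod[OF normal_D_N]
    by unfold_locales (simp add: relation_module_eq r_coset_N)
qed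

context presentation
begin

lemma relation_module_carrier: "carrier (relation_module X G \<theta>) = coset ` N"
  unfolding relation_module_eq FactGroup_def RCOSETS_def r_coset_N partial_object.simps
  by (simp add: UNION_singleton_eq_range)

lemma coset_closed: "n \<in> N \<Longrightarrow> coset n \<in> carrier (relation_module X G \<theta>)"
  unfolding relation_module_carrier by (rule imageI)

lemma coset_mult: "m \<in> N \<Longrightarrow> n \<in> N \<Longrightarrow>
    coset (m \<cdot> n) = coset m \<otimes>\<^bsub>relation_module X G \<theta>\<^esub> coset n"
  using coset.hom_mult[of m n] by simp

lemma coset_eq_one_iff:
  assumes "n \<in> N" shows "coset n = \<one>\<^bsub>relation_module X G \<theta>\<^esub> \<longleftrightarrow> n \<in> D"
proof -
  have one: "\<one>\<^bsub>relation_module X G \<theta>\<^esub> = D" by (simp add: relation_module_eq FactGroup_def)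
  note D = normal_imp_subgroup[OF normal_D]
  show ?thesis unfolding one
  proof
    show "n \<in> D" if "coset n = D" by (rule F.coset_join1[OF that N_closed[OF assms] D])
    show "coset n = D" if "n \<in> D" by (rule F.coset_join2[OF N_closed[OF assms] D that])
  qed
qed

lemma D_subset_N: "D \<subseteq> N"
  by (rule F.derived_incl[OF subset_refl subgroup_N])

lemma N_mult: "m \<in> N \<Longrightarrow> n \<in> N \<Longrightarrow> m \<cdot> n \<in> N"
  by (rule subgroup.m_closed[OF subgroup_N])

lemma N_inv: "n \<in> N \<Longrightarrow> finv n \<in> N"
  by (rule subgroup.m_inv_closed[OF subgroup_N])

lemma N_conj: "n \<in> N \<Longrightarrow> q \<in> carrier F \<Longrightarrow> finv q \<cdot> n \<cdot> q \<in> N"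
  by (rule normal.inv_op_closed1[OF normal_N])

lemma coset_D_mult:
  assumes "d \<in> D" "n \<in> N" shows "coset (d \<cdot> n) = coset n"
proof -
  have d: "d \<in> N" using assms(1) D_subset_N by (rule rev_subsetD)
  show ?thesis
    using coset_eq_one_iff[OF d] assms coset_closed[OF assms(2)] by (simp add: coset_mult d)
qed

text \<open>Two changes of representative. Replacing \<open>n\<close> by \<open>m\<close> multiplies
  by an element of \<open>D\<close>, which is normal in all of F(X); replacing \<open>q\<close> by
  \<open>q'\<close> conjugates by an element of \<open>N\<close>, which is trivial in the abelian
  quotient.\<close>

lemma coset_conj:
  assumes n: "n \<in> N" and m: "m \<in> coset n"
    and q: "q \<in> carrier F" and q': "q' \<in> carrier F" "\<theta> q' = \<theta> q"
  shows "coset (finv q' \<cdot> m \<cdot> q') = coset (finv q \<cdot> n \<cdot> q)"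
proof -
  obtain d where d: "d \<in> D" "m = d \<cdot> n" using m unfolding r_coset_def by (metis UN_E singletonD)
  have dN: "d \<in> N" using d(1) D_subset_N by (rule rev_subsetD)
  note F = N_closed[OF n] N_closed[OF dN]
  have mN: "m \<in> N" using d n dN by (simp add: N_mult)
  have "finv q \<cdot> m \<cdot> q = (finv q \<cdot> d \<cdot> q) \<cdot> (finv q \<cdot> n \<cdot> q)"
    using F q by (simp add: d F.m_assoc F_cancel)
  moreover have "finv q \<cdot> d \<cdot> q \<in> D" by (rule normal.inv_op_closed1[OF normal_D q d(1)])
  ultimately have 1: "coset (finv q \<cdot> m \<cdot> q) = coset (finv q \<cdot> n \<cdot> q)"
    using coset_D_mult N_conj[OF n q] by (simp only:)
  \<comment> \<open>\<open>q' = q ?k\<close> with \<open>?k\<close> in \<open>N\<close>, so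
    conjugating by \<open>q'\<close> is conjugating by \<open>q\<close> and then by
    \<open>?k\<close>.\<close>
  let ?k = "finv q \<cdot> q'" and ?x = "finv q \<cdot> m \<cdot> q"
  have k: "?k \<in> N" using q q' by (simp add: kernel_def)
  have x: "?x \<in> N" by (rule N_conj[OF mN q])
  note xk = coset_closed[OF x] coset_closed[OF k] coset_closed[OF N_inv[OF k]]
  have "finv q' \<cdot> m \<cdot> q' = finv ?k \<cdot> ?x \<cdot> ?k"
    using q q' N_closed[OF mN] by (simp add: F.m_assoc F.inv_mult_group F_cancel)
  then have "coset (finv q' \<cdot> m \<cdot> q') =
      coset (finv ?k) \<otimes>\<^bsub>relation_module X G \<theta>\<^esub> coset ?x \<otimes>\<^bsub>relation_module X G \<theta>\<^esub> coset ?k"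
    by (simp only: coset_mult N_mult N_inv x k)
  also have "\<dots> = coset ?x \<otimes>\<^bsub>relation_module X G \<theta>\<^esub>
      (coset (finv ?k) \<otimes>\<^bsub>relation_module X G \<theta>\<^esub> coset ?k)"
    by (simp only: A.m_comm[OF xk(3,1)] A.m_assoc[OF xk(1,3,2)])
  also have "coset (finv ?k) \<otimes>\<^bsub>relation_module X G \<theta>\<^esub> coset ?k = coset \<one>\<^bsub>F\<^esub>"
    using coset_mult[OF N_inv[OF k] k] F.l_inv[OF N_closed[OF k]] by (simp only:)
  also have "\<dots> = \<one>\<^bsub>relation_module X G \<theta>\<^esub>"
    using coset.hom_one by simp
  finally show ?thesis using 1 A.r_one[OF xk(1)] by (simp only:)
qed

lemma relation_module_act_coset:
  assumes n: "n \<in> N" and q: "q \<in> carrier F"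
  shows "relation_module_act X G \<theta> (coset n) (\<theta> q) = coset (finv q \<cdot> n \<cdot> q)"
  unfolding relation_module_act_def derived_N_group r_coset_N
proof (rule UN_eq_const)
  show "q \<in> {q' \<in> carrier F. \<theta> q' = \<theta> q}" using q by simp
  show "n \<in> coset n" by (rule F.rcos_self[OF N_closed[OF n] normal_imp_subgroup[OF normal_D]])
  fix q' m assume "q' \<in> {q' \<in> carrier F. \<theta> q' = \<theta> q}" "m \<in> coset n"
  then show "coset (finv q' \<cdot> m \<cdot> q') = coset (finv q \<cdot> n \<cdot> q)"
    using n q by (intro coset_conj) simp_all
qed

lemma boundary_in_N:
  assumes "y \<in> labels" shows "boundary y \<in> N"
  using boundary_closed[OF assms] \<theta>_boundary[OF assms] unfolding kernel_def by (intro CollectI conjI)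

text \<open>The boundary is a relator conjugated by the first component of the label, so
  \<open>coset_conj\<close> applies. It lets the map to the relation module be fixed on transversal
  labels only.\<close>

lemma coset_boundary:
  assumes "(q, i) \<in> labels" "q' \<in> carrier F" "\<theta> q' = \<theta> q"
  shows "coset (boundary (q', i)) = coset (boundary (q, i))"
proof -
  obtain l r where i: "i = (l, r)" by (cases i)
  have c: "q \<in> carrier F" "(l, r) \<in> R" using assms(1) by (simp_all add: labels_def i)
  let ?b = "finv (free_reduction l) \<cdot> free_reduction r"
  have b: "?b \<in> N" using relators_subset(1) c(2) unfolding relators_def by (simp add: subset_iff) metis
  show ?thesis unfolding i boundary.simps
    by (rule coset_conj[OF b F.rcos_self[OF N_closed[OF b] normal_imp_subgroup[OF normal_D]] c(1) assms(2,3)])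
qed

lemma count_gen:
  assumes "y \<in> labels" shows "count (gen y) = label_basis y"
proof -
  have "[(y, True)] \<in> label_words" using assms by simp
  then show ?thesis
    by (simp only: count_cls M.path_value.simps M.signed.simps if_True M.r_one label_basis_closed assms)
qed

lemma bd_gen:
  assumes "y \<in> labels" shows "bd (gen y) = boundary y"
proof -
  have "[(y, True)] \<in> label_words" using assms by simp
  then show ?thesis
    by (simp only: bd_cls F.path_value.simps F.signed.simps if_True F.r_one boundary_closed assms)
qed

lemma count_surj: "count ` carrier C = carrier (free_gmodule R G)"
proof (rule subgroup_free_gmodule_eq_carrier)
  show "subgroup (count ` carrier C) (free_gmodule R G)" by (rule count.img_is_subgroup)
  fix i g assume i: "i \<in> R" and g: "g \<in> carrier G"
  let ?y = "(transversal g, i)"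
  have y: "?y \<in> labels" using i transversal_closed[OF g] by (simp add: labels_def)
  have "count (gen ?y) = free_basis R i g"
    by (simp only: count_gen[OF y] label_basis.simps \<theta>_transversal[OF g])
  moreover have "gen ?y \<in> carrier C" using y by simp
  ultimately show "free_basis R i g \<in> count ` carrier C" by (metis imageI)
qed

lemma bd_hom_N: "bd \<in> hom C N_group"
  by (rule homI) (simp_all add: bd_in_N)

text \<open>\<psi> is prescribed on the basis by boundaries of transversal labels. Both composites
  are homomorphisms on the crossed module, so they are compared on generators, where
  \<open>coset_boundary\<close> removes the choice of label.\<close>

lemma relation_module_map:
  obtains \<psi> where "\<psi> \<in> hom (free_gmodule R G) (relation_module X G \<theta>)"
    and "\<And>c. c \<in> carrier C \<Longrightarrow> \<psi> (count c) = coset (bd c)"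
proof -
  have "coset (boundary (transversal g, i)) \<in> carrier (relation_module X G \<theta>)"
    if "i \<in> R" "g \<in> carrier G" for i g
    using that transversal_closed by (intro coset_closed boundary_in_N) (simp add: labels_def)
  then obtain \<psi> where \<psi>: "\<psi> \<in> hom (free_gmodule R G) (relation_module X G \<theta>)"
    and basis: "\<And>i g. i \<in> R \<Longrightarrow> g \<in> carrier G \<Longrightarrow>
      \<psi> (free_basis R i g) = coset (boundary (transversal g, i))"
    using free_gmodule_universal[of "relation_module X G \<theta>" R G
      "\<lambda>i g. coset (boundary (transversal g, i))", OF comm_group_relation_module] by metis
  have \<psi>count: "\<psi> \<circ> count \<in> hom C (relation_module X G \<theta>)" by (rule hom_compose[OF count.homh \<psi>])
  have cosetbd: "coset \<circ> bd \<in> hom C (relation_module X G \<theta>)" by (rule hom_compose[OF bd_hom_N coset.homh])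
  have gen: "gen \<in> labels \<rightarrow> carrier C" by (intro Pi_I) simp
  have "\<psi> (count c) = coset (bd c)" if cC: "c \<in> carrier C" for c
  proof -
    obtain w where w: "w \<in> label_words" "c = cls w" using cC by (rule crossed_module_cases)
    have w': "fst ` set w \<subseteq> labels" using w by (simp add: label_words_iff)
    have c: "c = C.path_value gen w" using w by (simp only: path_value_gen)
    have "(\<psi> \<circ> count) c = A.path_value (\<lambda>y. (\<psi> \<circ> count) (gen y)) w"
      unfolding c by (rule C.path_value_hom[OF A.group_axioms \<psi>count w' gen])
    also have "\<dots> = A.path_value (\<lambda>y. (coset \<circ> bd) (gen y)) w"
    proof (rule A.path_value_cong[OF w'])
      fix y assume y: "y \<in> labels"
      obtain q i where qi: "y = (q, i)" by (cases y)
      have q: "q \<in> carrier F" "i \<in> R" using y by (simp_all add: qi labels_def)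
      have "count (gen y) = free_basis R i (\<theta> q)"
        unfolding count_gen[OF y] by (simp only: qi label_basis.simps)
      then have "\<psi> (count (gen y)) = coset (boundary (transversal (\<theta> q), i))"
        using basis[OF q(2) \<theta>.hom_closed[OF q(1)]] by (simp only:)
      also have "\<dots> = coset (boundary y)"
        unfolding qi using y transversal[OF \<theta>.hom_closed[OF q(1)]] by (intro coset_boundary) (simp_all only: qi)
      also have "boundary y = bd (gen y)" by (rule bd_gen[OF y, symmetric])
      finally show "(\<psi> \<circ> count) (gen y) = (coset \<circ> bd) (gen y)" by (simp only: o_apply)
    qed
    also have "\<dots> = (coset \<circ> bd) c"
      unfolding c by (rule C.path_value_hom[OF A.group_axioms cosetbd w' gen, symmetric])
    finally show ?thesis by (simp only: o_apply)
  qed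
  with \<psi> show ?thesis by (rule that)
qed

text \<open>Every element of \<open>[N, N]\<close> is the boundary of a product of commutators, whose count vanishes.\<close>

lemma derived_lift:
  assumes "n \<in> D"
  shows "\<exists>c\<in>carrier C. bd c = n \<and> count c = \<one>\<^bsub>free_gmodule R G\<^esub>"
proof -
  \<comment> \<open>A homomorphism maps the derived subgroup onto the derived subgroup of its image:
    the image is \<open>N\<close> for \<open>bd\<close>, and abelian for
    \<open>count\<close>.\<close>
  have "bd ` derived C (carrier C) = D"
    using bd.derived_img[OF subset_refl] by (simp only: bd_image)
  then have "n \<in> bd ` derived C (carrier C)" using assms by (simp only:)
  then obtain c where c: "c \<in> derived C (carrier C)" "n = bd c" by (elim imageE)
  have "count ` derived C (carrier C) = {\<one>\<^bsub>free_gmodule R G\<^esub>}"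
    using count.derived_img[OF subset_refl] M.derived_eq_singleton[OF subset_refl]
    by (simp only: count_surj)
  then have "count c = \<one>\<^bsub>free_gmodule R G\<^esub>"
    using imageI[OF c(1), of count] by (simp only: singleton_iff)
  moreover have "c \<in> carrier C" by (rule subsetD[OF C.derived_in_carrier[OF subset_refl] c(1)])
  ultimately show ?thesis using c(2) by (intro bexI conjI) (simp_all only:)
qed

text \<open>An element of the kernel is the count of some \<open>x\<close> whose boundary lies in
  \<open>D\<close>. Correcting \<open>x\<close> by an element with the same boundary and zero count
  gives a word of boundary 1, that is, a loop with the prescribed count.\<close>

lemma \<phi>_image:
  assumes \<psi>: "\<And>c. c \<in> carrier C \<Longrightarrow> \<psi> (count c) = coset (bd c)"
  shows "\<phi> ` carrier (squier_pi1 X R) = kernel (free_gmodule R G) (relation_module X G \<theta>) \<psi>"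
proof
  show "\<phi> ` carrier (squier_pi1 X R) \<subseteq> kernel (free_gmodule R G) (relation_module X G \<theta>) \<psi>"
  proof (rule image_subsetI)
    fix \<alpha> assume "\<alpha> \<in> carrier (squier_pi1 X R)"
    then obtain a where a: "a \<in> squier_loops" and \<alpha>: "\<alpha> = sq_cls a"
      unfolding fundamental_group_carrier by (elim imageE)
    note w = squier_loops_labels[OF a]
    have "\<phi> \<alpha> = count (cls (path_labels a))" by (simp only: \<alpha> \<phi>_cls[OF a] count_cls[OF w(1)])
    moreover have "\<psi> (count (cls (path_labels a))) = coset \<one>\<^bsub>F\<^esub>"
      by (simp only: \<psi>[OF cls_closed[OF w(1)]] bd_cls[OF w(1)] w(3) one_F)
    moreover have "coset \<one>\<^bsub>F\<^esub> = \<one>\<^bsub>relation_module X G \<theta>\<^esub>" using coset.hom_one by simp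
    moreover have "count (cls (path_labels a)) \<in> carrier (free_gmodule R G)"
      by (rule count.hom_closed[OF cls_closed[OF w(1)]])
    ultimately show "\<phi> \<alpha> \<in> kernel (free_gmodule R G) (relation_module X G \<theta>) \<psi>"
      unfolding kernel_def by (simp only: mem_Collect_eq simp_thms)
  qed
  show "kernel (free_gmodule R G) (relation_module X G \<theta>) \<psi> \<subseteq> \<phi> ` carrier (squier_pi1 X R)"
  proof
    fix c assume "c \<in> kernel (free_gmodule R G) (relation_module X G \<theta>) \<psi>"
    then have "c \<in> count ` carrier C" and c1: "\<psi> c = \<one>\<^bsub>relation_module X G \<theta>\<^esub>"
      unfolding kernel_def count_surj by simp_all
    then obtain x where x: "x \<in> carrier C" "c = count x" by (elim imageE)
    then have "bd x \<in> D" using \<psi>[OF x(1)] c1 coset_eq_one_iff[OF bd_in_N[OF x(1)]] by simp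
    then obtain z where z: "z \<in> carrier C" "bd z = bd x" "count z = \<one>\<^bsub>free_gmodule R G\<^esub>"
      using derived_lift by metis
    \<comment> \<open>Dividing by \<open>z\<close> kills the boundary and leaves the count
      unchanged.\<close>
    let ?y = "x \<otimes>\<^bsub>C\<^esub> inv\<^bsub>C\<^esub> z"
    have y: "?y \<in> carrier C" "bd ?y = \<one>\<^bsub>F\<^esub>" "count ?y = c"
      using x z by simp_all
    obtain w where w: "w \<in> label_words" "?y = cls w" using y(1) by (rule crossed_module_cases)
    have "word_boundary w = []" using y(2) unfolding w(2) bd_cls[OF w(1)] by (simp only: one_F)
    note loop = lift_path_loop[OF w(1) this]
    have "\<phi> (sq_cls (lift_path [] w)) = c"
      using y(3) unfolding w(2) count_cls[OF w(1)] \<phi>_cls[OF loop(1)] loop(2) .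
    then show "c \<in> \<phi> ` carrier (squier_pi1 X R)" using sq_cls_closed[OF loop(1)] by (metis imageI)
  qed
qed

lemma exact_sequence:
  "\<exists>\<phi> \<psi>. short_exact_gmodules G
    (squier_pi1 X R) (pi1_act X R \<theta>)
    (free_gmodule R G) (free_gmodule_act R G)
    (relation_module X G \<theta>) (relation_module_act X G \<theta>) \<phi> \<psi>"
proof -
  obtain \<psi> where hom: "\<psi> \<in> hom (free_gmodule R G) (relation_module X G \<theta>)"
    and \<psi>: "\<And>c. c \<in> carrier C \<Longrightarrow> \<psi> (count c) = coset (bd c)"
    by (rule relation_module_map) (rule that)
  have "\<psi> ` carrier (free_gmodule R G) = (\<lambda>c. coset (bd c)) ` carrier C"
    unfolding count_surj[symmetric] image_image by (rule image_cong[OF refl \<psi>])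
  also have "\<dots> = coset ` bd ` carrier C" by (simp only: image_image)
  also have "\<dots> = carrier (relation_module X G \<theta>)" by (simp only: bd_image relation_module_carrier)
  finally have surj: "\<psi> ` carrier (free_gmodule R G) = carrier (relation_module X G \<theta>)" .
  have "right_gmodule_hom G (free_gmodule R G) (free_gmodule_act R G)
      (relation_module X G \<theta>) (relation_module_act X G \<theta>) \<psi>"
  proof (rule right_gmodule_hom_surj[OF right_gmodule_free_gmodule[OF group_G]
        comm_group_relation_module hom surj])
    \<comment> \<open>As \<open>count\<close> and \<theta> are onto, equivariance is tested on the
      count of a word and the image of some \<open>u\<close>; there the action is translation, which
      conjugates the boundary.\<close>
    fix x g assume "x \<in> carrier (free_gmodule R G)" and "g \<in> carrier G"
    then obtain c u where c: "c \<in> carrier C" "x = count c" and u: "u \<in> carrier F" "g = \<theta> u"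
      unfolding count_surj[symmetric] \<theta>_surj[symmetric] by (elim imageE)
    obtain w where w: "w \<in> label_words" "c = cls w" using c(1) by (rule crossed_module_cases)
    note w' = translate_word_closed[OF w(1) u(1)]
    have "free_gmodule_act R G x g = count (cls (translate_word u w))"
      by (simp only: c(2) u(2) w(2) count_cls[OF w(1)] count_cls[OF w'] word_count_translate[OF w(1) u(1)])
    then have "\<psi> (free_gmodule_act R G x g) = coset (finv u \<cdot> bd c \<cdot> u)"
      by (simp only: \<psi>[OF cls_closed[OF w']] bd_cls[OF w'] word_boundary_translate[OF w(1) u(1)]
          w(2) bd_cls[OF w(1)])
    also have "\<dots> = relation_module_act X G \<theta> (\<psi> x) g"
      by (simp only: c(2) u(2) \<psi>[OF c(1)] relation_module_act_coset[OF bd_in_N[OF c(1)] u(1)])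
    finally show "\<psi> (free_gmodule_act R G x g) = relation_module_act X G \<theta> (\<psi> x) g" .
  qed
  then have "short_exact_gmodules G (squier_pi1 X R) (pi1_act X R \<theta>) (free_gmodule R G)
      (free_gmodule_act R G) (relation_module X G \<theta>) (relation_module_act X G \<theta>) \<phi> \<psi>"
    unfolding short_exact_gmodules_def
    by (intro conjI \<phi>_gmodule_hom \<phi>_inj \<phi>_image[OF \<psi>] surj)
  then show ?thesis by (intro exI)
qed

end

theorem proposition3p8:
  fixes X :: "'x set" and R :: "('x word \<times> 'x word) set"
    and G :: "('g, 'm) monoid_scheme" and \<theta> :: "'x word \<Rightarrow> 'g"
  assumes "is_presentation X R G \<theta>"
  shows "\<exists>\<phi> \<psi>. short_exact_gmodules G
           (squier_pi1 X R) (pi1_act X R \<theta>)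
           (free_gmodule R G) (free_gmodule_act R G)
           (relation_module X G \<theta>) (relation_module_act X G \<theta>)
           \<phi> \<psi>"
proof -
  interpret presentation X R G \<theta> by unfold_locales (rule assms)
  show ?thesis by (rule exact_sequence)
qed

end
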